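(* Let $k<n$ be positive integers and assume that each triple of commuting nilpotent $n\times n$ matrices over $\mathbb{F}$ whose linear span contains a matrix of rank at least $k$ belongs to $\overline{R(3,n)}$. Let $(A,B,C)\in N(3,n)$ be a triple such that the Jordan canonical form of $A$ has one Jordan block of order $k$ and $n-k$ zero Jordan blocks (i.e. nilpotent Jordan blocks of order $1$). Then $(A,B,C)\in \overline{R(3,n)}$.
   Context: $\mathbb{F}$ is an algebraically closed field of arbitrary characteristic. $N(3,n)\subseteq M_n(\mathbb{F})^3$ is the set of all triples of pairwise commuting nilpotent $n\times n$ matrices. A matrix is 1-regular if each of its eigenspaces is at most 1-dimensional (so a nilpotent $n\times n$ matrix is 1-regular iff its Jordan form is a single block of order $n$). $R(3,n)$ is the set of all $(A_1,A_2,A_3)\in N(3,n)$ such that the linear span of $A_1,A_2,A_3$ contains a 1-regular matrix. $\overline{S}$ denotes the closure of $S$ in the Zariski topology. *)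

theory Defs
  imports
    "HOL-Analysis.Abstract_Topology"
    "HOL-Computational_Algebra.Polynomial"
    "Jordan_Normal_Form.Jordan_Normal_Form"
    "Jordan_Normal_Form.Matrix_Kernel"
    "Jordan_Normal_Form.DL_Rank"
begin

type_synonym 'a mat3 = "'a mat \<times> 'a mat \<times> 'a mat"

definition carrier_mat3 :: "nat \<Rightarrow> 'a mat3 set" where
  "carrier_mat3 n = carrier_mat n n \<times> carrier_mat n n \<times> carrier_mat n n"

text \<open>The polynomial functions in the \<open>3 n\<^sup>2\<close> matrix entries of a triple.\<close>

inductive_set mat3_polyfun :: "nat \<Rightarrow> ('a :: comm_ring_1 mat3 \<Rightarrow> 'a) set" for n :: nat where
  const: "(\<lambda>_. c) \<in> mat3_polyfun n"
| entry1: "i < n \<Longrightarrow> j < n \<Longrightarrow> (\<lambda>(A, B, C). A $$ (i, j)) \<in> mat3_polyfun n"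
| entry2: "i < n \<Longrightarrow> j < n \<Longrightarrow> (\<lambda>(A, B, C). B $$ (i, j)) \<in> mat3_polyfun n"
| entry3: "i < n \<Longrightarrow> j < n \<Longrightarrow> (\<lambda>(A, B, C). C $$ (i, j)) \<in> mat3_polyfun n"
| add: "p \<in> mat3_polyfun n \<Longrightarrow> q \<in> mat3_polyfun n \<Longrightarrow> (\<lambda>X. p X + q X) \<in> mat3_polyfun n"
| mult: "p \<in> mat3_polyfun n \<Longrightarrow> q \<in> mat3_polyfun n \<Longrightarrow> (\<lambda>X. p X * q X) \<in> mat3_polyfun n"

definition zero_locus :: "nat \<Rightarrow> ('a :: comm_ring_1 mat3 \<Rightarrow> 'a) set \<Rightarrow> 'a mat3 set" where
  "zero_locus n P = {X \<in> carrier_mat3 n. \<forall>p\<in>P. p X = 0}"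

definition zariski :: "nat \<Rightarrow> 'a :: idom mat3 topology" where
  "zariski n = topology (\<lambda>U. \<exists>P \<subseteq> mat3_polyfun n. U = carrier_mat3 n - zero_locus n P)"

text \<open>The following lemmas confirm that the argument of \<^const>\<open>topology\<close> above is a topology,
  whose closed sets are exactly the algebraic subsets.\<close>

lemma istopology_zariski:
  "istopology (\<lambda>U :: 'a :: idom mat3 set.
     \<exists>P \<subseteq> mat3_polyfun n. U = carrier_mat3 n - zero_locus n P)"
  unfolding istopology_def
proof (intro conjI allI impI)
  fix S T :: "'a mat3 set"
  assume "\<exists>P \<subseteq> mat3_polyfun n. S = carrier_mat3 n - zero_locus n P"
    and "\<exists>P \<subseteq> mat3_polyfun n. T = carrier_mat3 n - zero_locus n P"
  then obtain P Q where P: "P \<subseteq> mat3_polyfun n" "S = carrier_mat3 n - zero_locus n P"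
    and Q: "Q \<subseteq> mat3_polyfun n" "T = carrier_mat3 n - zero_locus n Q" by blast
  let ?R = "(\<lambda>(p, q) X. p X * q X) ` (P \<times> Q)"
  have "?R \<subseteq> mat3_polyfun n"
    using P(1) Q(1) by (auto intro!: mat3_polyfun.mult)
  moreover have "S \<inter> T = carrier_mat3 n - zero_locus n ?R"
    unfolding P(2) Q(2) zero_locus_def by auto
  ultimately show "\<exists>P \<subseteq> mat3_polyfun n. S \<inter> T = carrier_mat3 n - zero_locus n P" by blast
next
  fix K :: "'a mat3 set set"
  assume "\<forall>U\<in>K. \<exists>P \<subseteq> mat3_polyfun n. U = carrier_mat3 n - zero_locus n P"
  then obtain f where f: "\<And>U. U \<in> K \<Longrightarrow> f U \<subseteq> mat3_polyfun n"
    "\<And>U. U \<in> K \<Longrightarrow> U = carrier_mat3 n - zero_locus n (f U)" by metis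
  have "\<Union>K = carrier_mat3 n - zero_locus n (\<Union>U\<in>K. f U)"
  proof -
    have "\<Union>K = (\<Union>U\<in>K. carrier_mat3 n - zero_locus n (f U))"
      using f(2) by auto
    also have "\<dots> = carrier_mat3 n - zero_locus n (\<Union>U\<in>K. f U)"
      unfolding zero_locus_def by auto
    finally show ?thesis .
  qed
  moreover have "(\<Union>U\<in>K. f U) \<subseteq> mat3_polyfun n" using f(1) by blast
  ultimately show "\<exists>P \<subseteq> mat3_polyfun n. \<Union>K = carrier_mat3 n - zero_locus n P" by blast
qed

lemma openin_zariski:
  "openin (zariski n) U \<longleftrightarrow> (\<exists>P \<subseteq> mat3_polyfun n. U = carrier_mat3 n - zero_locus n P)"
  unfolding zariski_def by (simp add: topology_inverse'[OF istopology_zariski])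

lemma topspace_zariski: "topspace (zariski n :: 'a :: idom mat3 topology) = carrier_mat3 n"
proof -
  have "zero_locus n {\<lambda>_ :: 'a mat3. 1} = {}" unfolding zero_locus_def by auto
  then have "openin (zariski n) (carrier_mat3 n :: 'a mat3 set)"
    unfolding openin_zariski
    by (intro exI[of _ "{\<lambda>_. 1}"]) (auto intro: mat3_polyfun.const)
  then show ?thesis
    unfolding topspace_def using openin_zariski by blast
qed

lemma closedin_zariski:
  "closedin (zariski n) Z \<longleftrightarrow> (\<exists>P \<subseteq> mat3_polyfun n. Z = zero_locus n P)"
proof -
  have "zero_locus n P \<subseteq> carrier_mat3 n" for P :: "('a mat3 \<Rightarrow> 'a) set"
    unfolding zero_locus_def by auto
  then show ?thesis
    unfolding closedin_def openin_zariski topspace_zariski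
    by (metis double_diff equalityE)
qed

definition nilpotent_mat :: "'a :: semiring_1 mat \<Rightarrow> bool" where
  "nilpotent_mat A \<longleftrightarrow> (\<exists>m. A ^\<^sub>m m = 0\<^sub>m (dim_row A) (dim_row A))"

text \<open>The eigenspace of \<open>A\<close> for \<open>c\<close> is the kernel of \<^term>\<open>char_matrix A c\<close>, i.e.\ of
  \<open>A - c I\<close>; it has dimension 0 if \<open>c\<close> is not an eigenvalue.\<close>

definition one_regular :: "'a :: field mat \<Rightarrow> bool" where
  "one_regular A \<longleftrightarrow> (\<forall>c. kernel_dim (char_matrix A c) \<le> 1)"

definition span3 :: "'a :: semiring_1 mat \<Rightarrow> 'a mat \<Rightarrow> 'a mat \<Rightarrow> 'a mat set" where
  "span3 A B C = {a \<cdot>\<^sub>m A + b \<cdot>\<^sub>m B + c \<cdot>\<^sub>m C | a b c. True}"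

definition N3 :: "nat \<Rightarrow> 'a :: semiring_1 mat3 set" where
  "N3 n = {(A, B, C) \<in> carrier_mat3 n.
     nilpotent_mat A \<and> nilpotent_mat B \<and> nilpotent_mat C \<and>
     A * B = B * A \<and> A * C = C * A \<and> B * C = C * B}"

definition R3 :: "nat \<Rightarrow> 'a :: field mat3 set" where
  "R3 n = {(A, B, C) \<in> N3 n. \<exists>M \<in> span3 A B C. one_regular M}"

end

theory Submission
  imports Defs
begin

text \<open>
  A Zariski closed set that contains a polynomial curve away from \<open>t = 0\<close> contains its point at
  \<open>t = 0\<close>. So it suffices to join \<open>(A, B, C)\<close> by such curves to triples whose span contains a matrix
  of rank at least \<open>k\<close>; \<open>R(3,n)\<close> itself enters only through the hypothesis.

  Put \<open>A\<close> in Jordan form \<open>J\<close> and let \<open>k \<ge> 2\<close>. A nilpotent matrix commuting with \<open>J\<close> consists of a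
  nilpotent Toeplitz block of order \<open>k\<close>, a row \<open>u\<close> on top of the upper right block, a column \<open>w\<close>
  at the right end of the lower left block, and an arbitrary lower right corner. If the corner of
  \<open>B\<close> or \<open>C\<close> is nonzero, the span contains a matrix of rank \<open>k\<close> already. Otherwise let \<open>(u, w)\<close>
  belong to \<open>B\<close> and \<open>(z, y)\<close> to \<open>C\<close>.

  If \<open>n - k \<ge> 2\<close>, choose \<open>(\<alpha>, \<beta>) \<noteq> 0\<close> with \<open>(\<beta>u - \<alpha>z) \<cdot> (\<beta>w - \<alpha>y) = 0\<close>, a quadratic condition.
  There is a square-zero rank one matrix \<open>Y\<close> in the corner annihilated by \<open>\<beta>u - \<alpha>z\<close> from the left
  and \<open>\<beta>w - \<alpha>y\<close> from the right, and \<open>(J, B + t\<alpha>Y, C + t\<beta>Y)\<close> is the desired curve.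

  If \<open>n - k = 1\<close>, commutation reads \<open>uy = zw\<close>, so up to polynomials in \<open>J\<close> both \<open>B\<close> and \<open>C\<close> are
  multiples of one matrix \<open>E\<close>, and one may assume \<open>u = 1\<close>, \<open>w = s \<noteq> 0\<close> for \<open>E\<close>. On the algebra
  \<open>F[x]/(x\<^sup>k\<^sup>+\<^sup>1)\<close> multiplication by \<open>x\<close> is regular nilpotent. With \<open>y = d (x/e + \<dots> + (x/e)\<^sup>k)\<close> the
  multiplications by \<open>x\<close> and \<open>y\<close> have, in the basis \<open>1, x, \<dots>, x\<^sup>k\<^sup>-\<^sup>1, y\<close>, entries polynomial in \<open>t\<close>
  for \<open>e = t\<^sup>2\<close> and \<open>d = \<gamma>t\<^sup>k\<^sup>-\<^sup>1\<close> with \<open>\<gamma>\<^sup>2 = - s\<close>, and they become \<open>J\<close> and \<open>E\<close> at \<open>t = 0\<close>.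
\<close>

subsection \<open>Polynomial curves\<close>

text \<open>Over a finite field the product of all \<open>X - a\<close>, plus 1, has positive degree
  and takes the value 1 everywhere, so it has no root.\<close>

lemma infinite_UNIV_alg_closed: "infinite (UNIV :: 'a :: alg_closed_field set)"
proof
  assume fin: "finite (UNIV :: 'a set)"
  define q :: "'a poly" where "q = (\<Prod>a\<in>UNIV. [:- a, 1:])"
  have "degree q = card (UNIV :: 'a set)"
    unfolding q_def by (subst degree_prod_eq_sum_degree) auto
  then have deg: "degree q > 0" using fin by (simp add: card_gt_0_iff)
  then have "degree (q + 1) > 0" by (simp add: degree_add_eq_left)
  then obtain x where "poly (q + 1) x = 0" using alg_closed_imp_poly_has_root by blast
  moreover have "poly q x = 0" unfolding q_def poly_prod using fin by (auto simp: prod_zero_iff)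
  ultimately show False by simp
qed

text \<open>A predicate on functions instead of the type \<open>poly\<close>, so that the entries of
  a curve can stay plain terms in \<open>t\<close> and polynomiality is proved by following their
  structure.\<close>

definition poly_fun :: "('a :: comm_ring_1 \<Rightarrow> 'a) \<Rightarrow> bool" where
  "poly_fun f \<longleftrightarrow> (\<exists>p. \<forall>t. f t = poly p t)"

lemma poly_funI: "(\<And>t. f t = poly p t) \<Longrightarrow> poly_fun f"
  unfolding poly_fun_def by blast

lemma poly_fun_const [intro]: "poly_fun (\<lambda>_. c)"
  by (rule poly_funI[of _ "[:c:]"]) simp

lemma poly_fun_id [intro]: "poly_fun (\<lambda>t. t)"
  by (rule poly_funI[of _ "[:0, 1:]"]) simp

lemma poly_fun_add [intro]: "poly_fun f \<Longrightarrow> poly_fun g \<Longrightarrow> poly_fun (\<lambda>t. f t + g t)"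
  unfolding poly_fun_def by (metis poly_add)

lemma poly_fun_mult [intro]: "poly_fun f \<Longrightarrow> poly_fun g \<Longrightarrow> poly_fun (\<lambda>t. f t * g t)"
  unfolding poly_fun_def by (metis poly_mult)

lemma poly_fun_uminus [intro]: "poly_fun f \<Longrightarrow> poly_fun (\<lambda>t. - f t)"
  unfolding poly_fun_def by (metis poly_minus)

lemma poly_fun_diff [intro]: "poly_fun f \<Longrightarrow> poly_fun g \<Longrightarrow> poly_fun (\<lambda>t. f t - g t)"
  unfolding poly_fun_def by (metis poly_diff)

lemma poly_fun_power [intro]: "poly_fun f \<Longrightarrow> poly_fun (\<lambda>t. f t ^ m)"
  unfolding poly_fun_def by (metis poly_power)

lemma poly_fun_if [intro]: "poly_fun f \<Longrightarrow> poly_fun g \<Longrightarrow> poly_fun (\<lambda>t. if b then f t else g t)"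
  by (cases b) auto

lemma poly_fun_sum [intro]: "(\<And>i. i \<in> I \<Longrightarrow> poly_fun (f i)) \<Longrightarrow> poly_fun (\<lambda>t. \<Sum>i\<in>I. f i t)"
  by (induction I rule: infinite_finite_induct) auto

lemma poly_fun_prod [intro]: "(\<And>i. i \<in> I \<Longrightarrow> poly_fun (f i)) \<Longrightarrow> poly_fun (\<lambda>t. \<Prod>i\<in>I. f i t)"
  by (induction I rule: infinite_finite_induct) auto

text \<open>A polynomial with infinitely many roots is zero. The lemma serves twice: for limits in
  closed sets, and read backwards to find \<open>t \<noteq> 0\<close> at which a determinant that is
  nonzero at 0 is still nonzero.\<close>

lemma poly_fun_eq_0_at_0:
  fixes f :: "'a :: alg_closed_field \<Rightarrow> 'a"
  assumes "poly_fun f" and "\<And>t. t \<noteq> 0 \<Longrightarrow> f t = 0"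
  shows "f 0 = 0"
proof -
  obtain p where p: "\<And>t. f t = poly p t" using assms(1) unfolding poly_fun_def by blast
  have "UNIV - {0} \<subseteq> {t. poly p t = 0}" using assms(2) p by auto
  moreover have "infinite (UNIV - {0 :: 'a})" using infinite_UNIV_alg_closed by simp
  ultimately have "p = 0" using poly_roots_finite finite_subset by blast
  then show ?thesis by (simp add: p)
qed

definition mat_curve :: "nat \<Rightarrow> nat \<Rightarrow> ('a :: comm_ring_1 \<Rightarrow> 'a mat) \<Rightarrow> bool" where
  "mat_curve m n F \<longleftrightarrow>
     (\<forall>t. F t \<in> carrier_mat m n) \<and> (\<forall>i<m. \<forall>j<n. poly_fun (\<lambda>t. F t $$ (i, j)))"

lemma mat_curve_carrier: "mat_curve m n F \<Longrightarrow> F t \<in> carrier_mat m n"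
  unfolding mat_curve_def by blast

lemma mat_curve_const [intro]: "A \<in> carrier_mat m n \<Longrightarrow> mat_curve m n (\<lambda>_. A)"
  unfolding mat_curve_def by auto

lemma mat_curve_mat [intro]:
  assumes "\<And>i j. i < m \<Longrightarrow> j < n \<Longrightarrow> poly_fun (\<lambda>t. f t i j)"
  shows "mat_curve m n (\<lambda>t. mat m n (\<lambda>(i, j). f t i j))"
  unfolding mat_curve_def using assms by simp

lemma mat_curve_add [intro]:
  assumes "mat_curve m n F" "mat_curve m n G"
  shows "mat_curve m n (\<lambda>t. F t + G t)"
proof -
  have "(F t + G t) $$ (i, j) = F t $$ (i, j) + G t $$ (i, j)" if "i < m" "j < n" for t i j
    using assms[THEN mat_curve_carrier, of t] that by auto
  then show ?thesis using assms unfolding mat_curve_def by auto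
qed

lemma mat_curve_smult [intro]:
  assumes "poly_fun c" "mat_curve m n F"
  shows "mat_curve m n (\<lambda>t. c t \<cdot>\<^sub>m F t)"
proof -
  have "(c t \<cdot>\<^sub>m F t) $$ (i, j) = c t * F t $$ (i, j)" if "i < m" "j < n" for t i j
    using assms(2)[THEN mat_curve_carrier, of t] that by auto
  then show ?thesis using assms unfolding mat_curve_def by auto
qed

lemma mat_curve_mult:
  assumes F: "mat_curve m n F" and G: "mat_curve n r G"
  shows "mat_curve m r (\<lambda>t. F t * G t)"
proof -
  have "(F t * G t) $$ (i, j) = (\<Sum>l\<in>{0..<n}. F t $$ (i, l) * G t $$ (l, j))"
    if "i < m" "j < r" for t i j
    using F[THEN mat_curve_carrier, of t] G[THEN mat_curve_carrier, of t] that
    by (auto simp: scalar_prod_def)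
  moreover have "poly_fun (\<lambda>t. \<Sum>l\<in>{0..<n}. F t $$ (i, l) * G t $$ (l, j))"
    if "i < m" "j < r" for i j
    using F G that unfolding mat_curve_def by (intro poly_fun_sum poly_fun_mult) auto
  ultimately show ?thesis
    using mult_carrier_mat[OF F[THEN mat_curve_carrier] G[THEN mat_curve_carrier]]
    unfolding mat_curve_def by auto
qed

lemma poly_fun_det:
  assumes "mat_curve n n F"
  shows "poly_fun (\<lambda>t. det (F t))"
proof -
  have "det (F t) = (\<Sum>p\<in>{p. p permutes {0..<n}}. signof p * (\<Prod>i = 0..<n. F t $$ (i, p i)))" for t
    by (rule det_def'[OF mat_curve_carrier[OF assms]])
  moreover have "poly_fun
      (\<lambda>t. \<Sum>p\<in>{p. p permutes {0..<n}}. signof p * (\<Prod>i = 0..<n. F t $$ (i, p i)))"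
    using assms unfolding mat_curve_def
    by (intro poly_fun_sum poly_fun_mult poly_fun_prod) (auto simp: permutes_in_image)
  ultimately show ?thesis by simp
qed

lemma poly_fun_polyfun_curve:
  assumes "p \<in> mat3_polyfun n" "mat_curve n n A" "mat_curve n n B" "mat_curve n n C"
  shows "poly_fun (\<lambda>t. p (A t, B t, C t))"
  using assms
proof (induction rule: mat3_polyfun.induct)
  case (add p q)
  then show ?case using poly_fun_add by blast
next
  case (mult p q)
  then show ?case using poly_fun_mult by blast
qed (use poly_fun_const in \<open>simp_all add: mat_curve_def\<close>)

text \<open>The consequence of Zariski closedness on which all limit arguments rest: a polynomial
  curve that lies in \<open>S\<close> off 0 lies in \<open>S\<close> at 0.\<close>

definition curve_closed :: "nat \<Rightarrow> 'a :: comm_ring_1 mat3 set \<Rightarrow> bool" where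
  "curve_closed n S \<longleftrightarrow>
     (\<forall>A B C. mat_curve n n A \<longrightarrow> mat_curve n n B \<longrightarrow> mat_curve n n C \<longrightarrow>
        (\<forall>t. t \<noteq> 0 \<longrightarrow> (A t, B t, C t) \<in> S) \<longrightarrow> (A 0, B 0, C 0) \<in> S)"

lemma curve_closedD:
  assumes "curve_closed n S" "mat_curve n n A" "mat_curve n n B" "mat_curve n n C"
    and "\<And>t. t \<noteq> 0 \<Longrightarrow> (A t, B t, C t) \<in> S"
  shows "(A 0, B 0, C 0) \<in> S"
  using assms unfolding curve_closed_def by blast

lemma closedin_zariski_curve_closed:
  fixes S :: "'a :: alg_closed_field mat3 set"
  assumes "closedin (zariski n) S"
  shows "curve_closed n S"
  unfolding curve_closed_def
proof (intro allI impI)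
  fix A B C :: "'a \<Rightarrow> 'a mat"
  assume curves: "mat_curve n n A" "mat_curve n n B" "mat_curve n n C"
    and S: "\<forall>t. t \<noteq> 0 \<longrightarrow> (A t, B t, C t) \<in> S"
  obtain P where P: "P \<subseteq> mat3_polyfun n" and SP: "S = zero_locus n P"
    using assms closedin_zariski by blast
  have "p (A 0, B 0, C 0) = 0" if "p \<in> P" for p
    using poly_fun_eq_0_at_0[OF poly_fun_polyfun_curve[OF _ curves]] that P S
    unfolding SP zero_locus_def by blast
  then show "(A 0, B 0, C 0) \<in> S"
    using curves[THEN mat_curve_carrier] unfolding SP zero_locus_def carrier_mat3_def by auto
qed

text \<open>Multiplication by constant matrices maps curves to curves. With \<open>Q\<close> inverse
  to \<open>P\<close> this permits a change of basis before any curve is constructed.\<close>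

lemma curve_closed_conj:
  assumes "curve_closed n S" and P: "P \<in> carrier_mat n n" and Q: "Q \<in> carrier_mat n n"
  shows "curve_closed n {(A, B, C). (P * A * Q, P * B * Q, P * C * Q) \<in> S}"
  unfolding curve_closed_def
proof (intro allI impI CollectI case_prodI)
  fix A B C
  assume *: "mat_curve n n A" "mat_curve n n B" "mat_curve n n C"
    "\<forall>t. t \<noteq> 0 \<longrightarrow> (A t, B t, C t) \<in> {(A, B, C). (P * A * Q, P * B * Q, P * C * Q) \<in> S}"
  have "mat_curve n n (\<lambda>t. P * F t * Q)" if "mat_curve n n F" for F
    by (intro mat_curve_mult[where n = n] mat_curve_const that P Q)
  then show "(P * A 0 * Q, P * B 0 * Q, P * C 0 * Q) \<in> S"
    using * by (intro curve_closedD[OF assms(1), where A = "\<lambda>t. P * A t * Q"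
        and B = "\<lambda>t. P * B t * Q" and C = "\<lambda>t. P * C t * Q"]) auto
qed

subsection \<open>Rank\<close>

text \<open>Rank at least \<open>k\<close>, in a form whose invariance under conjugation is immediate.\<close>

definition has_minor :: "nat \<Rightarrow> nat \<Rightarrow> 'a :: field mat \<Rightarrow> bool" where
  "has_minor k n M \<longleftrightarrow>
     (\<exists>X\<in>carrier_mat k n. \<exists>Y\<in>carrier_mat n k. det (X * M * Y) \<noteq> 0)"

text \<open>The left test matrix selects the rows \<open>f a\<close>; the right one selects the
  columns \<open>g b\<close> and scales them by \<open>c b\<close>. The scaling makes it possible to
  divide a column by the parameter of a pencil.\<close>

lemma has_minorI:
  assumes M: "M \<in> carrier_mat n n"
    and f: "\<And>a. a < k \<Longrightarrow> f a < n" and g: "\<And>a. a < k \<Longrightarrow> g a < n"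
    and det: "det (mat k k (\<lambda>(a, b). M $$ (f a, g b) * c b)) \<noteq> 0"
  shows "has_minor k n M"
proof -
  define X where "X = mat k n (\<lambda>(a, i). if i = f a then 1 else 0 :: 'a)"
  define Y where "Y = mat n k (\<lambda>(j, b). if j = g b then c b else 0)"
  have XM: "X * M = mat k n (\<lambda>(a, j). M $$ (f a, j))"
  proof (rule eq_matI)
    fix a j assume "a < dim_row (mat k n (\<lambda>(a, j). M $$ (f a, j)))"
      "j < dim_col (mat k n (\<lambda>(a, j). M $$ (f a, j)))"
    then have aj: "a < k" "j < n" by auto
    then have "(X * M) $$ (a, j) = (\<Sum>i = 0..<n. (if i = f a then 1 else 0) * M $$ (i, j))"
      using M by (simp add: X_def scalar_prod_def)
    also have "\<dots> = (\<Sum>i = 0..<n. if i = f a then M $$ (i, j) else 0)"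
      by (rule sum.cong) auto
    also have "\<dots> = M $$ (f a, j)" using f[OF aj(1)] by simp
    finally show "(X * M) $$ (a, j) = mat k n (\<lambda>(a, j). M $$ (f a, j)) $$ (a, j)" using aj by simp
  qed (use M in \<open>auto simp: X_def\<close>)
  have "X * M * Y = mat k k (\<lambda>(a, b). M $$ (f a, g b) * c b)"
  proof (rule eq_matI)
    fix a b assume "a < dim_row (mat k k (\<lambda>(a, b). M $$ (f a, g b) * c b))"
      "b < dim_col (mat k k (\<lambda>(a, b). M $$ (f a, g b) * c b))"
    then have ab: "a < k" "b < k" by auto
    then have "(X * M * Y) $$ (a, b) = (\<Sum>j = 0..<n. M $$ (f a, j) * (if j = g b then c b else 0))"
      unfolding XM by (simp add: Y_def scalar_prod_def)
    also have "\<dots> = (\<Sum>j = 0..<n. if j = g b then M $$ (f a, j) * c b else 0)"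
      by (rule sum.cong) auto
    also have "\<dots> = M $$ (f a, g b) * c b" using g[OF ab(2)] by simp
    finally show "(X * M * Y) $$ (a, b) = mat k k (\<lambda>(a, b). M $$ (f a, g b) * c b) $$ (a, b)"
      using ab by simp
  qed (auto simp: X_def Y_def)
  moreover have "X \<in> carrier_mat k n" "Y \<in> carrier_mat n k" by (auto simp: X_def Y_def)
  ultimately show ?thesis using det unfolding has_minor_def by metis
qed

text \<open>If \<open>X\<close> and \<open>Y\<close> witness the minor of \<open>M\<close>, then
  \<open>X * Q\<close> and \<open>P * Y\<close> witness the same determinant for
  \<open>P * M * Q\<close>, since the inner factors \<open>Q * P\<close> cancel.\<close>

lemma has_minor_conj:
  assumes "has_minor k n M" and [simp]: "M \<in> carrier_mat n n" "P \<in> carrier_mat n n" "Q \<in> carrier_mat n n"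
    and QP: "Q * P = 1\<^sub>m n"
  shows "has_minor k n (P * M * Q)"
proof -
  obtain X Y where [simp]: "X \<in> carrier_mat k n" "Y \<in> carrier_mat n k" and d: "det (X * M * Y) \<noteq> 0"
    using assms(1) unfolding has_minor_def by blast
  have c: "P * M \<in> carrier_mat n n" "P * M * Q \<in> carrier_mat n n" "P * Y \<in> carrier_mat n k"
    "M * Y \<in> carrier_mat n k" "P * (M * Y) \<in> carrier_mat n k"
    by (rule mult_carrier_mat[of _ n n] mult_carrier_mat[of _ k n] | fact)+
  have QPZ: "Q * (P * Z) = Z" if "Z \<in> carrier_mat n k" for Z
    using that by (simp flip: assoc_mult_mat[of Q n n P n Z k] add: QP)
  have "P * M * Q * (P * Y) = P * M * Y"
    using c QPZ[of Y] by (simp add: assoc_mult_mat[of "P * M" n n Q n "P * Y" k])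
  also have "\<dots> = P * (M * Y)"
    by (rule assoc_mult_mat[of _ n n _ n _ k]) auto
  finally have "X * Q * (P * M * Q) * (P * Y) = X * Q * (P * (M * Y))"
    using c mult_carrier_mat[of X k n Q n]
    by (subst assoc_mult_mat[of "X * Q" k n "P * M * Q" n "P * Y" k]) auto
  also have "\<dots> = X * (M * Y)"
    using c QPZ[of "M * Y"] by (subst assoc_mult_mat[of _ k n _ n _ k]) auto
  also have "\<dots> = X * M * Y" by (rule assoc_mult_mat[symmetric, of _ k n _ n _ k]) auto
  finally show ?thesis using d unfolding has_minor_def
    by (metis \<open>X \<in> carrier_mat k n\<close> \<open>Y \<in> carrier_mat n k\<close> assms(3,4) mult_carrier_mat)
qed

lemma (in vec_space) mult_mat_vec_in_span_cols:
  assumes A: "A \<in> carrier_mat n m" and v: "v \<in> carrier_vec m"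
  shows "A *\<^sub>v v \<in> span (set (cols A))"
proof -
  have "A *\<^sub>v v \<in> col_space A" using A v by (subst col_space_eq) auto
  then show ?thesis by (simp add: col_space_def)
qed

text \<open>Each column of \<open>A * B\<close> is \<open>A\<close> applied to a column of
  \<open>B\<close>, so the column space can only shrink.\<close>

lemma (in vec_space) rank_mult_le:
  assumes A: "A \<in> carrier_mat n m" and B: "B \<in> carrier_mat m l"
  shows "rank (A * B) \<le> rank A"
proof -
  have cA: "set (cols A) \<subseteq> carrier_vec n" using A cols_dim by blast
  have AB: "A * B \<in> carrier_mat n l" using A B by simp
  have cAB: "set (cols (A * B)) \<subseteq> carrier_vec n" using AB cols_dim by blast
  have "set (cols (A * B)) \<subseteq> span (set (cols A))"
  proof
    fix x assume "x \<in> set (cols (A * B))"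
    then obtain i where "i < l" "x = col (A * B) i"
      using AB by (auto simp: cols_def)
    then have "x = A *\<^sub>v col B i" using A B by (auto intro!: eq_vecI)
    then show "x \<in> span (set (cols A))"
      using mult_mat_vec_in_span_cols[OF A] B \<open>i < l\<close> by auto
  qed
  then have sub: "span (set (cols (A * B))) \<subseteq> span (set (cols A))"
    using span_is_subspace[OF cA] by (intro span_is_subset) (auto simp: subspace_def)
  have "subspace class_ring (span (set (cols (A * B)))) (span_vs (set (cols A)))"
    by (rule nested_subspaces[OF span_is_subspace[OF cA] span_is_subspace[OF cAB] sub])
  from vectorspace.subspace_dim[OF subspace_is_vs[OF span_is_subspace[OF cA]] this]
  show ?thesis unfolding rank_def using fin_dim_span_cols[OF A] fin_dim_span_cols[OF AB] by simp
qed

text \<open>Invertibility of \<open>X * (M * Y)\<close> forces the \<open>k\<close> columns of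
  \<open>M * Y\<close> to be independent, so \<open>k\<close> is the rank of \<open>M * Y\<close>
  and bounds that of \<open>M\<close> from below.\<close>

lemma has_minor_rank:
  assumes M: "M \<in> carrier_mat n n" and "has_minor k n M"
  shows "k \<le> vec_space.rank n M"
proof -
  obtain X Y where X: "X \<in> carrier_mat k n" and Y: "Y \<in> carrier_mat n k"
    and d: "det (X * M * Y) \<noteq> 0"
    using assms(2) unfolding has_minor_def by blast
  interpret vec_space "TYPE('a)" n .
  define Z where "Z = M * Y"
  have Z: "Z \<in> carrier_mat n k" unfolding Z_def using M Y by simp
  have XZ: "X * Z \<in> carrier_mat k k" using X Z by simp
  have dZ: "det (X * Z) \<noteq> 0" using d X M Y by (simp add: Z_def assoc_mult_mat[OF X M Y])
  \<comment> \<open>Independence is a property of the set of columns, which has \<open>k\<close>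
    elements only if no column is repeated; a repeated one would make the determinant
    vanish.\<close>
  have dist: "distinct (cols Z)"
  proof (rule ccontr)
    assume "\<not> distinct (cols Z)"
    then obtain i j where ij: "i < k" "j < k" "i \<noteq> j" "col Z i = col Z j"
      using Z unfolding distinct_conv_nth by auto
    then have "col (X * Z) i = col (X * Z) j" using X Z by simp
    then have "det (X * Z) = 0" using det_identical_cols[OF XZ] ij by blast
    then show False using dZ by simp
  qed
  have "lin_indpt (set (cols Z))"
  proof
    assume "lin_dep (set (cols Z))"
    then obtain v where v: "v \<in> carrier_vec k" "v \<noteq> 0\<^sub>v k" "Z *\<^sub>v v = 0\<^sub>v n"
      using lin_depE[OF Z _ dist] by blast
    have "(X * Z) *\<^sub>v v = X *\<^sub>v 0\<^sub>v n" using v by (simp add: assoc_mult_mat_vec[OF X Z v(1)])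
    also have "\<dots> = 0\<^sub>v k" using X by (intro eq_vecI) auto
    finally have "(X * Z) *\<^sub>v v = 0\<^sub>v k" .
    then show False using det_0_iff_vec_prod_zero_field[OF XZ] dZ v by blast
  qed
  then have "k = rank Z" using lin_indpt_full_rank[OF Z dist] by simp
  also have "\<dots> \<le> rank M" unfolding Z_def by (rule rank_mult_le[OF M Y])
  finally show ?thesis .
qed

subsection \<open>Nilpotent matrices\<close>

lemma pow_mat_Suc_left: "A \<in> carrier_mat n n \<Longrightarrow> A ^\<^sub>m Suc d = A * A ^\<^sub>m d"
proof (induction d)
  case (Suc d)
  have "A ^\<^sub>m Suc (Suc d) = A * A ^\<^sub>m d * A" using Suc by simp
  also have "\<dots> = A * (A ^\<^sub>m d * A)"
    using Suc.prems by (intro assoc_mult_mat[of _ n n _ n _ n]) auto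
  finally show ?case by simp
qed simp

lemma pow_mat_eq_0_mono:
  assumes A: "A \<in> carrier_mat n n" and "A ^\<^sub>m d = 0\<^sub>m n n" and "d \<le> e"
  shows "A ^\<^sub>m e = 0\<^sub>m n n"
  using assms(3)
proof (induction e rule: dec_induct)
  case (step e)
  then show ?case using A by simp
qed (rule assms(2))

text \<open>\<open>B\<close> and \<open>Y\<close> need not commute: the last hypothesis kills every word with two letters \<open>Y\<close>.\<close>

lemma nilpotent_mat_add:
  fixes B Y :: "'a :: comm_ring_1 mat"
  assumes B: "B \<in> carrier_mat n n" and Y: "Y \<in> carrier_mat n n" and nil: "nilpotent_mat B"
    and YBY: "\<And>i. Y * (B ^\<^sub>m i * Y) = 0\<^sub>m n n"
  shows "nilpotent_mat (B + Y)"
proof -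
  define M where "M = B + Y"
  have M: "M \<in> carrier_mat n n" using B Y by (simp add: M_def)
  obtain d where d: "B ^\<^sub>m d = 0\<^sub>m n n" using nil B unfolding nilpotent_mat_def by auto
  have pB: "B ^\<^sub>m i \<in> carrier_mat n n" and pM: "M ^\<^sub>m i \<in> carrier_mat n n" for i
    using B M by auto
  \<comment> \<open>To the right of a letter \<open>Y\<close>, every further \<open>Y\<close> in the
    expansion of \<open>M ^\<^sub>m i\<close> is killed.\<close>
  have YM: "Y * M ^\<^sub>m i = Y * B ^\<^sub>m i" for i
  proof (induction i)
    case (Suc i)
    have "Y * M ^\<^sub>m Suc i = Y * M ^\<^sub>m i * M"
      using assoc_mult_mat[OF Y pM M] by simp
    also have "\<dots> = Y * B ^\<^sub>m i * B + Y * B ^\<^sub>m i * Y"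
      unfolding Suc unfolding M_def by (rule mult_add_distrib_mat[OF mult_carrier_mat[OF Y pB] B Y])
    also have "Y * B ^\<^sub>m i * Y = 0\<^sub>m n n" using assoc_mult_mat[OF Y pB Y] YBY by simp
    also have "Y * B ^\<^sub>m i * B = Y * B ^\<^sub>m Suc i" using assoc_mult_mat[OF Y pB B] by simp
    finally show ?case using mult_carrier_mat[OF Y pB[of "Suc i"]] by simp
  qed (use B M in simp)
  \<comment> \<open>Since \<open>Y * M ^\<^sub>m (d + j) = Y * B ^\<^sub>m (d + j) = 0\<close>, each
    factor \<open>M\<close> beyond the first \<open>d\<close> acts as \<open>B\<close>; after
    \<open>d\<close> of these the product is zero.\<close>
  have Mpow: "M ^\<^sub>m (d + j) = B ^\<^sub>m j * M ^\<^sub>m d" for j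
  proof (induction j)
    case (Suc j)
    have "Y * M ^\<^sub>m (d + j) = 0\<^sub>m n n"
      unfolding YM using pow_mat_eq_0_mono[OF B d, of "d + j"] Y by simp
    then have "M * M ^\<^sub>m (d + j) = B * M ^\<^sub>m (d + j)"
      using mult_carrier_mat[OF B pM] add_mult_distrib_mat[OF B Y pM, of "d + j"] by (simp add: M_def)
    also have "\<dots> = B * B ^\<^sub>m j * M ^\<^sub>m d" unfolding Suc by (rule assoc_mult_mat[OF B pB pM, symmetric])
    finally show ?case using pow_mat_Suc_left[OF M, of "d + j"] pow_mat_Suc_left[OF B, of j] by simp
  qed (use M B in simp)
  have "M ^\<^sub>m (d + d) = 0\<^sub>m n n" unfolding Mpow d by (rule left_mult_zero_mat[OF pM])
  then show ?thesis using M unfolding nilpotent_mat_def M_def[symmetric] by auto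
qed

lemma nilpotent_mat_strict_upper:
  fixes T :: "'a :: comm_ring_1 mat"
  assumes T: "T \<in> carrier_mat n n" and upper: "\<And>i j. i < n \<Longrightarrow> j \<le> i \<Longrightarrow> T $$ (i, j) = 0"
  shows "nilpotent_mat T"
proof -
  \<comment> \<open>Each factor moves the support one more diagonal away from the main one.\<close>
  have "(T ^\<^sub>m d) $$ (i, j) = 0" if "i < n" "j < n" "j < i + d" for d i j
    using that
  proof (induction d arbitrary: j)
    case (Suc d)
    have "(T ^\<^sub>m d) $$ (i, l) * T $$ (l, j) = 0" if "l < n" for l
      using Suc.IH[of l] upper[of l j] Suc.prems that by (cases "l < i + d") auto
    then show ?case using T Suc.prems by (auto simp: scalar_prod_def intro!: sum.neutral)
  qed (use T in auto)
  then have "T ^\<^sub>m n = 0\<^sub>m n n" using T by (intro eq_matI) auto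
  then show ?thesis using T unfolding nilpotent_mat_def by auto
qed

section \<open>Transport of nilpotency and commutation along a similarity\<close>

lemma intertwine_pow:
  assumes [simp]: "X \<in> carrier_mat n n" "T \<in> carrier_mat n n" "Q \<in> carrier_mat n n" and "X * Q = Q * T"
  shows "X ^\<^sub>m d * Q = Q * T ^\<^sub>m d"
proof (induction d)
  case (Suc d)
  have "X ^\<^sub>m Suc d * Q = X ^\<^sub>m d * (Q * T)"
    using assms(4) assoc_mult_mat[of "X ^\<^sub>m d" n n X n Q n] by simp
  also have "\<dots> = Q * T ^\<^sub>m d * T" using Suc assoc_mult_mat[of "X ^\<^sub>m d" n n Q n T n] by simp
  also have "\<dots> = Q * T ^\<^sub>m Suc d" using assoc_mult_mat[of Q n n "T ^\<^sub>m d" n T n] by simp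
  finally show ?case .
next
  case 0
  have "dim_row X = n" "dim_row T = n" using assms(1,2) by blast+
  then show ?case by (simp only: pow_mat.simps left_mult_one_mat[OF assms(3)] right_mult_one_mat[OF assms(3)])
qed

lemma eq_if_mult_right_inverse:
  fixes X :: "'a :: comm_ring_1 mat"
  assumes "X \<in> carrier_mat n n" "Y \<in> carrier_mat n n" "Q \<in> carrier_mat n n" "Q' \<in> carrier_mat n n"
    and "Q * Q' = 1\<^sub>m n" and "X * Q = Y * Q"
  shows "X = Y"
proof -
  have "X = X * Q * Q'" using assoc_mult_mat[of X n n Q n Q' n] assms(1-5) by simp
  also have "\<dots> = Y" using assoc_mult_mat[of Y n n Q n Q' n] assms(2-5) unfolding assms(6) by simp
  finally show ?thesis .
qed

text \<open>Similarity is phrased as \<open>X * Q = Q * T\<close>, which for the deformed matrices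
  can be checked entry by entry without the inverse of \<open>Q\<close>; the right inverse only
  cancels \<open>Q\<close> at the end.\<close>

lemma intertwine_commute:
  fixes X :: "'a :: comm_ring_1 mat"
  assumes X: "X \<in> carrier_mat n n" and Y: "Y \<in> carrier_mat n n" and T: "T \<in> carrier_mat n n"
    and S: "S \<in> carrier_mat n n" and Q: "Q \<in> carrier_mat n n" and Q': "Q' \<in> carrier_mat n n"
    and QQ': "Q * Q' = 1\<^sub>m n" and XQ: "X * Q = Q * T" and YQ: "Y * Q = Q * S" and TS: "T * S = S * T"
  shows "X * Y = Y * X"
proof (rule eq_if_mult_right_inverse[OF _ _ Q Q' QQ'])
  have "X * Y * Q = Q * T * S"
    using assoc_mult_mat[OF X Y Q] assoc_mult_mat[OF X Q S] by (simp add: XQ YQ)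
  also have "\<dots> = Q * S * T" using assoc_mult_mat[OF Q T S] assoc_mult_mat[OF Q S T] TS by simp
  also have "\<dots> = Y * X * Q" using assoc_mult_mat[OF Y X Q] assoc_mult_mat[OF Y Q T] by (simp add: XQ YQ)
  finally show "X * Y * Q = Y * X * Q" .
qed (use X Y in auto)

lemma intertwine_nilpotent:
  fixes X :: "'a :: comm_ring_1 mat"
  assumes X: "X \<in> carrier_mat n n" and T: "T \<in> carrier_mat n n"
    and Q: "Q \<in> carrier_mat n n" and Q': "Q' \<in> carrier_mat n n"
    and QQ': "Q * Q' = 1\<^sub>m n" and XQ: "X * Q = Q * T" and nil: "nilpotent_mat T"
  shows "nilpotent_mat X"
proof -
  obtain d where d: "T ^\<^sub>m d = 0\<^sub>m n n" using nil T unfolding nilpotent_mat_def by auto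
  have "X ^\<^sub>m d * Q = 0\<^sub>m n n * Q" using intertwine_pow[OF X T Q XQ, of d] d Q by simp
  then have "X ^\<^sub>m d = 0\<^sub>m n n"
    using eq_if_mult_right_inverse[OF _ _ Q Q' QQ'] X by (meson pow_carrier_mat zero_carrier_mat)
  then show ?thesis using X unfolding nilpotent_mat_def by auto
qed

lemma N3_conj:
  fixes X :: "'a :: comm_ring_1 mat"
  assumes N: "(X, Y, Z) \<in> N3 n" and P: "P \<in> carrier_mat n n" and Q: "Q \<in> carrier_mat n n"
    and PQ: "P * Q = 1\<^sub>m n" and QP: "Q * P = 1\<^sub>m n"
  shows "(P * X * Q, P * Y * Q, P * Z * Q) \<in> N3 n"
proof -
  have c: "P * W * Q \<in> carrier_mat n n" if "W \<in> carrier_mat n n" for W using that P Q by simp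
  have i: "P * W * Q * P = P * W" if "W \<in> carrier_mat n n" for W
    using that assoc_mult_mat[of "P * W" n n Q n P n] P Q QP by simp
  have X: "X \<in> carrier_mat n n" and Y: "Y \<in> carrier_mat n n" and Z: "Z \<in> carrier_mat n n"
    and nil: "nilpotent_mat X" "nilpotent_mat Y" "nilpotent_mat Z"
    and com: "X * Y = Y * X" "X * Z = Z * X" "Y * Z = Z * Y"
    using N by (auto simp: N3_def carrier_mat3_def)
  have com': "P * V * Q * (P * W * Q) = P * W * Q * (P * V * Q)"
    if "V \<in> carrier_mat n n" "W \<in> carrier_mat n n" "V * W = W * V" for V W
    by (rule intertwine_commute[OF c c _ _ P Q PQ i i]) (fact that)+
  have nil': "nilpotent_mat (P * W * Q)" if "W \<in> carrier_mat n n" "nilpotent_mat W" for W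
    by (rule intertwine_nilpotent[OF c _ P Q PQ i]) (fact that)+
  show ?thesis
    using c[OF X] c[OF Y] c[OF Z] nil'[OF X nil(1)] nil'[OF Y nil(2)] nil'[OF Z nil(3)]
      com'[OF X Y com(1)] com'[OF X Z com(2)] com'[OF Y Z com(3)]
    by (simp add: N3_def carrier_mat3_def)
qed

subsection \<open>Toeplitz matrices\<close>

text \<open>For a field these are the polynomials without constant term in one nilpotent Jordan
  block; \<open>h d\<close> is the entry on the \<open>d\<close>-th superdiagonal, for
  \<open>d\<close> at least 1.\<close>

definition toeplitz :: "nat \<Rightarrow> (nat \<Rightarrow> 'a) \<Rightarrow> 'a :: zero mat" where
  "toeplitz n h = mat n n (\<lambda>(i, j). if i < j then h (j - i) else 0)"

lemma toeplitz_carrier [simp]: "toeplitz n h \<in> carrier_mat n n"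
  by (simp add: toeplitz_def)

lemma nilpotent_toeplitz: "nilpotent_mat (toeplitz n h :: 'a :: comm_ring_1 mat)"
  by (rule nilpotent_mat_strict_upper[of _ n]) (auto simp: toeplitz_def)

lemma toeplitz_mult_index:
  fixes g h :: "nat \<Rightarrow> 'a :: comm_ring_1"
  assumes "i < n" "j < n"
  shows "(toeplitz n g * toeplitz n h) $$ (i, j) = (\<Sum>l\<in>{i<..<j}. g (l - i) * h (j - l))"
proof -
  have "(toeplitz n g * toeplitz n h) $$ (i, j) =
      (\<Sum>l\<in>{0..<n}. if l \<in> {i<..<j} then g (l - i) * h (j - l) else 0)"
    using assms by (auto simp: toeplitz_def scalar_prod_def intro!: sum.cong)
  also have "\<dots> = (\<Sum>l\<in>{0..<n} \<inter> {i<..<j}. g (l - i) * h (j - l))"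
    by (simp add: sum.inter_restrict)
  also have "{0..<n} \<inter> {i<..<j} = {i<..<j}" using assms by auto
  finally show ?thesis .
qed

lemma toeplitz_commute:
  "toeplitz n g * toeplitz n h = toeplitz n h * (toeplitz n g :: 'a :: comm_ring_1 mat)"
proof (rule eq_matI)
  fix i j assume "i < dim_row (toeplitz n h * toeplitz n g)" "j < dim_col (toeplitz n h * toeplitz n g)"
  then have ij: "i < n" "j < n" by (auto simp: toeplitz_def)
  \<comment> \<open>The reflection \<open>l \<mapsto> i + j - l\<close> of the open interval
    exchanges \<open>l - i\<close> and \<open>j - l\<close>.\<close>
  have "(\<Sum>l\<in>{i<..<j}. g (l - i) * h (j - l)) = (\<Sum>l\<in>{i<..<j}. h (l - i) * g (j - l))"
    by (rule sum.reindex_bij_witness[of _ "\<lambda>l. i + j - l" "\<lambda>l. i + j - l"]) (auto simp: mult.commute)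
  then show "(toeplitz n g * toeplitz n h) $$ (i, j) = (toeplitz n h * toeplitz n g) $$ (i, j)"
    by (simp only: toeplitz_mult_index[OF ij])
qed (simp_all add: toeplitz_def)

subsection \<open>Polynomials without constant term in a matrix\<close>

text \<open>Horner form of \<open>c1 A + c2 A^2 + ...\<close>: the list entry at index
  \<open>i\<close> belongs to the power \<open>i + 1\<close>. Writing the Toeplitz part of a
  commuting matrix this way lets it follow any deformation of \<open>A\<close>.\<close>

fun nil_poly :: "'a :: comm_ring_1 list \<Rightarrow> 'a mat \<Rightarrow> 'a mat" where
  "nil_poly [] A = 0\<^sub>m (dim_row A) (dim_row A)"
| "nil_poly (c # cs) A = c \<cdot>\<^sub>m A + A * nil_poly cs A"

lemma nil_poly_carrier [simp]: "A \<in> carrier_mat n n \<Longrightarrow> nil_poly cs A \<in> carrier_mat n n"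
  by (induction cs) auto

lemma mat_curve_nil_poly: "mat_curve n n F \<Longrightarrow> mat_curve n n (\<lambda>t. nil_poly cs (F t))"
proof (induction cs)
  case Nil
  then have "dim_row (F t) = n" for t using mat_curve_carrier[of n n F] by blast
  then show ?case by (simp add: mat_curve_const)
next
  case (Cons c cs)
  show ?case unfolding nil_poly.simps
    by (intro mat_curve_add mat_curve_smult poly_fun_const mat_curve_mult[where n = n] Cons)
qed

lemma nil_poly_intertwine:
  assumes X: "X \<in> carrier_mat n n" and T: "T \<in> carrier_mat n n" and Q: "Q \<in> carrier_mat n n"
    and XQ: "X * Q = Q * T"
  shows "nil_poly cs X * Q = Q * nil_poly cs T"
proof (induction cs)
  case Nil
  then show ?case using X T Q by simp
next
  case (Cons c cs)
  have "nil_poly (c # cs) X * Q = c \<cdot>\<^sub>m X * Q + X * nil_poly cs X * Q"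
    using X Q by (simp add: add_mult_distrib_mat[of _ n n _ _ n])
  also have "c \<cdot>\<^sub>m X * Q = Q * (c \<cdot>\<^sub>m T)"
    using X Q T XQ by (simp add: mult_smult_distrib[of _ n n _ n] mult_smult_assoc_mat[of _ n n _ n])
  also have "X * nil_poly cs X * Q = X * Q * nil_poly cs T"
    using assoc_mult_mat[of X n n "nil_poly cs X" n Q n] assoc_mult_mat[of X n n Q n "nil_poly cs T" n]
      X Q T Cons by simp
  also have "\<dots> = Q * (T * nil_poly cs T)"
    unfolding XQ using T Q by (intro assoc_mult_mat[of _ n n _ n _ n]) auto
  finally show ?case
    using T Q by (simp add: mult_add_distrib_mat[of _ n n _ n])
qed

definition jordan_part :: "nat \<Rightarrow> nat \<Rightarrow> 'a :: zero_neq_one mat" where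
  "jordan_part n k = mat n n (\<lambda>(i, j). if j = Suc i \<and> j < k then 1 else 0)"

lemma jordan_part_carrier [simp]: "jordan_part n k \<in> carrier_mat n n"
  by (simp add: jordan_part_def)

lemma jordan_part_mult_index:
  assumes M: "M \<in> carrier_mat n m" and "i < n" "j < m" "k \<le> n"
  shows "(jordan_part n k * M) $$ (i, j) = (if Suc i < k then M $$ (Suc i, j) else 0 :: 'a :: comm_ring_1)"
proof -
  have "(jordan_part n k * M) $$ (i, j) =
      (\<Sum>l\<in>{0..<n}. (if l = Suc i \<and> l < k then 1 else 0) * M $$ (l, j))"
    using assms by (auto simp: jordan_part_def scalar_prod_def)
  also have "\<dots> = (\<Sum>l\<in>{0..<n}. if l = Suc i then (if Suc i < k then M $$ (Suc i, j) else 0) else 0)"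
    by (rule sum.cong) auto
  finally show ?thesis using assms by simp
qed

lemma mult_jordan_part_index:
  assumes M: "M \<in> carrier_mat m n" and "i < m" "j < n"
  shows "(M * jordan_part n k) $$ (i, j) = (if 0 < j \<and> j < k then M $$ (i, j - 1) else 0 :: 'a :: comm_ring_1)"
proof -
  have "(M * jordan_part n k) $$ (i, j) =
      (\<Sum>l\<in>{0..<n}. M $$ (i, l) * (if j = Suc l \<and> j < k then 1 else 0))"
    using assms by (auto simp: jordan_part_def scalar_prod_def)
  also have "\<dots> = (\<Sum>l\<in>{0..<n}. if l = j - 1 then (if 0 < j \<and> j < k then M $$ (i, j - 1) else 0) else 0)"
    by (rule sum.cong) auto
  also have "\<dots> = (if 0 < j \<and> j < k then M $$ (i, j - 1) else 0)"
    using assms by (subst sum.delta) auto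
  finally show ?thesis .
qed

lemma nil_poly_jordan_part_index:
  assumes "i < n" "j < n" "k \<le> n"
  shows "nil_poly cs (jordan_part n k) $$ (i, j) =
    (if i < j \<and> j < k \<and> j - i \<le> length cs then cs ! (j - i - 1) else 0 :: 'a :: comm_ring_1)"
  using assms
proof (induction cs arbitrary: i)
  case Nil
  then show ?case by (auto simp: jordan_part_def)
next
  case (Cons c cs)
  have J: "jordan_part n k $$ (i, j) = (if j = Suc i \<and> j < k then 1 else 0 :: 'a)"
    using Cons.prems by (simp add: jordan_part_def)
  have "nil_poly (c # cs) (jordan_part n k) $$ (i, j) =
      c * jordan_part n k $$ (i, j) + (jordan_part n k * nil_poly cs (jordan_part n k)) $$ (i, j)"
  proof -
    have d: "dim_row (jordan_part n k * nil_poly cs (jordan_part n k)) = n"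
      "dim_col (jordan_part n k * nil_poly cs (jordan_part n k)) = n"
      "dim_row (jordan_part n k) = n" "dim_col (jordan_part n k) = n"
      "dim_row (nil_poly cs (jordan_part n k)) = n" "dim_col (nil_poly cs (jordan_part n k)) = n" for k
      using carrier_matD[OF nil_poly_carrier[OF jordan_part_carrier[of n k], of cs]]
        carrier_matD[OF jordan_part_carrier[of n k]] by simp_all
    show ?thesis using Cons.prems by (simp add: d del: index_mult_mat(1))
  qed
  also have "\<dots> = (if j = Suc i \<and> j < k then c else 0) +
      (if Suc i < k then nil_poly cs (jordan_part n k) $$ (Suc i, j) else 0)"
    using Cons.prems by (subst jordan_part_mult_index[of _ n n]) (auto simp: J)
  also have "\<dots> = (if i < j \<and> j < k \<and> j - i \<le> length (c # cs) then (c # cs) ! (j - i - 1) else 0)"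
    using Cons.prems Cons.IH[of "Suc i"] by (auto simp: nth_Cons' )
  finally show ?case .
qed

lemma jordan_part_self: "jordan_part n n = toeplitz n (\<lambda>d. if d = 1 then 1 else 0)"
  by (rule eq_matI) (auto simp: jordan_part_def toeplitz_def)

lemma nil_poly_jordan_part_self:
  "nil_poly cs (jordan_part n n :: 'a :: comm_ring_1 mat) =
     toeplitz n (\<lambda>d. if d \<le> length cs then cs ! (d - 1) else 0)"
  by (rule eq_matI)
    (auto simp: toeplitz_def nil_poly_jordan_part_index carrier_matD[OF nil_poly_carrier[OF jordan_part_carrier]])

lemma jordan_part_jordan_matrix:
  assumes "k \<le> n"
  shows "jordan_matrix ((k, 0) # replicate (n - k) (1, 0)) = (jordan_part n k :: 'a :: comm_ring_1 mat)"
proof -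
  have r: "jordan_matrix (replicate m (1, 0)) = (0\<^sub>m m m :: 'a mat)" for m
  proof (induction m)
    case 0
    then show ?case by (auto simp: jordan_matrix_def)
  next
    case (Suc m)
    show ?case unfolding replicate_Suc jordan_matrix_Cons Suc
      by (rule eq_matI) (auto simp: sum_list_replicate)
  qed
  show ?thesis unfolding jordan_matrix_Cons r using assms
    by (intro eq_matI) (auto simp: jordan_part_def sum_list_replicate)
qed

subsection \<open>The commutant of a single Jordan block plus zero\<close>

text \<open>Left multiplication by the Jordan part shifts the first \<open>k\<close> rows up, right
  multiplication shifts the first \<open>k\<close> columns to the right. All four facts come from
  comparing entries of the two products.\<close>

lemma commutant_jordan_part:
  fixes B :: "'a :: idom mat"
  assumes B: "B \<in> carrier_mat n n" and k: "2 \<le> k" "k \<le> n"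
    and comm: "jordan_part n k * B = B * jordan_part n k"
  shows commutant_col_0: "\<And>i. 0 < i \<Longrightarrow> i < n \<Longrightarrow> B $$ (i, 0) = 0"
    and commutant_upper_right: "\<And>i j. 0 < i \<Longrightarrow> i < k \<Longrightarrow> k \<le> j \<Longrightarrow> j < n \<Longrightarrow> B $$ (i, j) = 0"
    and commutant_lower_left: "\<And>i j. k \<le> i \<Longrightarrow> i < n \<Longrightarrow> j < k - 1 \<Longrightarrow> B $$ (i, j) = 0"
    and commutant_block: "\<And>i j. i < k \<Longrightarrow> j < k \<Longrightarrow> B $$ (i, j) = (if i \<le> j then B $$ (0, j - i) else 0)"
proof -
  have *: "(if Suc i < k then B $$ (Suc i, j) else 0) = (if 0 < j \<and> j < k then B $$ (i, j - 1) else 0)"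
    if "i < n" "j < n" for i j
    using jordan_part_mult_index[OF B that k(2)] mult_jordan_part_index[OF B that, of k] comm by simp
  show col0: "B $$ (i, 0) = 0" if "0 < i" "i < n" for i
  proof (cases "i < k")
    case True
    then show ?thesis using *[of "i - 1" 0] that k by simp
  next
    case False
    \<comment> \<open>For a row below the block, column 1 of the comparison is the one that shows
      column 0; it lies in the block because \<open>k \<ge> 2\<close>.\<close>
    then show ?thesis using *[of i 1] that k by simp
  qed
  show "B $$ (i, j) = 0" if "0 < i" "i < k" "k \<le> j" "j < n" for i j
    using *[of "i - 1" j] that k by simp
  show "B $$ (i, j) = 0" if "k \<le> i" "i < n" "j < k - 1" for i j
  proof -
    have "Suc j < k" using that k by simp
    then show ?thesis using *[of i "Suc j"] that k by simp
  qed
  show "B $$ (i, j) = (if i \<le> j then B $$ (0, j - i) else 0)" if "i < k" "j < k" for i j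
    using that
  proof (induction i arbitrary: j)
    case (Suc i)
    then show ?case
      using col0[of "Suc i"] *[of i j] k by (cases j) auto
  qed simp
qed

text \<open>The first basis vector is an eigenvector with eigenvalue \<open>B $$ (0, 0)\<close>, and
  a nilpotent matrix has no nonzero eigenvalue.\<close>

lemma nilpotent_mat_entry_00:
  fixes B :: "'a :: idom mat"
  assumes B: "B \<in> carrier_mat n n" and n: "0 < n" and nil: "nilpotent_mat B"
    and col0: "\<And>i. 0 < i \<Longrightarrow> i < n \<Longrightarrow> B $$ (i, 0) = 0"
  shows "B $$ (0, 0) = 0"
proof -
  have "(B ^\<^sub>m d) $$ (0, 0) = B $$ (0, 0) ^ d" for d
  proof (induction d)
    case (Suc d)
    have "(B ^\<^sub>m Suc d) $$ (0, 0) = (\<Sum>l = 0..<n. (B ^\<^sub>m d) $$ (0, l) * B $$ (l, 0))"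
      using B n by (simp add: scalar_prod_def)
    also have "\<dots> = (\<Sum>l = 0..<n. if l = 0 then (B ^\<^sub>m d) $$ (0, 0) * B $$ (0, 0) else 0)"
      using col0 by (intro sum.cong) auto
    finally show ?case using Suc n by simp
  qed (use B n in simp)
  moreover obtain d where "B ^\<^sub>m d = 0\<^sub>m n n" using nil B unfolding nilpotent_mat_def by auto
  ultimately have "B $$ (0, 0) ^ d = 0" using n by (metis index_zero_mat(1))
  then show ?thesis by simp
qed

text \<open>The \<open>k - 1\<close> ones of the Jordan part together with the entry
  \<open>(i0, j0)\<close> give a \<open>k\<close> by \<open>k\<close> minor. Its column
  \<open>j0\<close> comes from \<open>s \<cdot>\<^sub>m B\<close> alone, so it may be divided by
  \<open>s\<close>.\<close>

lemma jordan_part_pencil_has_minor: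
  fixes B :: "'a :: alg_closed_field mat"
  assumes B: "B \<in> carrier_mat n n" and k: "0 < k" and i0: "k \<le> i0" "i0 < n" and j0: "k \<le> j0" "j0 < n"
    and nz: "B $$ (i0, j0) \<noteq> 0"
  shows "\<exists>s. has_minor k n (jordan_part n k + s \<cdot>\<^sub>m B)"
proof -
  define f where "f a = (if a = k - 1 then i0 else a)" for a
  define g where "g b = (if b = k - 1 then j0 else b + 1)" for b
  have f: "f a < n" and g: "g a < n" if "a < k" for a
    using that i0 j0 by (auto simp: f_def g_def)
  \<comment> \<open>The selected submatrix of the pencil after that division: it is polynomial in
    \<open>s\<close>, and at \<open>s = 0\<close> it is upper triangular with diagonal 1, ..., 1,
    \<open>B $$ (i0, j0)\<close>.\<close>
  define D where "D s = mat k k (\<lambda>(a, b). if b = k - 1 then B $$ (f a, j0)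
    else (if a = b then 1 else 0) + s * B $$ (f a, Suc b))" for s
  have "upper_triangular (D 0)" by (auto simp: upper_triangular_def D_def)
  then have "det (D 0) = 0 \<longleftrightarrow> 0 \<in> set (diag_mat (D 0))"
    by (intro upper_triangular_imp_det_eq_0_iff) (auto simp: D_def)
  also have "\<not> \<dots>" using nz by (auto simp: diag_mat_def D_def f_def)
  finally have "det (D 0) \<noteq> 0" .
  moreover have "poly_fun (\<lambda>s. det (D s))"
    unfolding D_def by (intro poly_fun_det[where n = k] mat_curve_mat poly_fun_if poly_fun_add poly_fun_mult
      poly_fun_const poly_fun_id)
  ultimately obtain s where s: "s \<noteq> 0" "det (D s) \<noteq> 0" using poly_fun_eq_0_at_0 by blast
  let ?M = "jordan_part n k + s \<cdot>\<^sub>m B"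
  have "mat k k (\<lambda>(a, b). ?M $$ (f a, g b) * (if b = k - 1 then 1 / s else 1)) = D s"
  proof (rule eq_matI)
    fix a b assume "a < dim_row (D s)" "b < dim_col (D s)"
    then have ab: "a < k" "b < k" by (auto simp: D_def)
    then have "?M $$ (f a, g b) = (if g b = Suc (f a) \<and> g b < k then 1 else 0) + s * B $$ (f a, g b)"
      using B f[of a] g[of b] by (simp add: jordan_part_def)
    then show "mat k k (\<lambda>(a, b). ?M $$ (f a, g b) * (if b = k - 1 then 1 / s else 1)) $$ (a, b)
        = D s $$ (a, b)"
      using ab s(1) i0 j0 by (auto simp: D_def f_def g_def)
  qed (auto simp: D_def)
  then have "has_minor k n ?M" using B f g s(2) by (intro has_minorI[of _ n k f g "\<lambda>b. if b = k - 1 then 1 / s else 1"]) auto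
  then show ?thesis ..
qed

subsection \<open>Perturbing by a matrix of rank one\<close>

definition outer :: "nat \<Rightarrow> (nat \<Rightarrow> 'a) \<Rightarrow> (nat \<Rightarrow> 'a) \<Rightarrow> 'a :: comm_ring_1 mat" where
  "outer n p q = mat n n (\<lambda>(i, j). p i * q j)"

lemma outer_carrier [simp]: "outer n p q \<in> carrier_mat n n"
  by (simp add: outer_def)

lemma mat_mult_index:
  assumes "A \<in> carrier_mat m n" "B \<in> carrier_mat n r" "i < m" "j < r"
  shows "(A * B) $$ (i, j) = (\<Sum>l = 0..<n. A $$ (i, l) * B $$ (l, j))"
  using assms by (auto simp: scalar_prod_def)

lemma mult_outer_index:
  assumes "B \<in> carrier_mat n n" "i < n" "j < n"
  shows "(B * outer n p q) $$ (i, j) = (\<Sum>l = 0..<n. B $$ (i, l) * p l) * q j"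
  using assms by (auto simp: outer_def scalar_prod_def sum_distrib_right mult.assoc)

lemma outer_mult_index:
  assumes "B \<in> carrier_mat n n" "i < n" "j < n"
  shows "(outer n p q * B) $$ (i, j) = p i * (\<Sum>l = 0..<n. q l * B $$ (l, j))"
  using assms by (auto simp: outer_def scalar_prod_def sum_distrib_left mult.assoc)

section \<open>Products of a commutant element with a rank one matrix in the corner\<close>

context
  fixes n k :: nat and B :: "'a :: idom mat"
  assumes B: "B \<in> carrier_mat n n" and k: "2 \<le> k" "k \<le> n"
    and comm: "jordan_part n k * B = B * jordan_part n k" and nil: "nilpotent_mat B"
    and corner: "\<And>i j. k \<le> i \<Longrightarrow> i < n \<Longrightarrow> k \<le> j \<Longrightarrow> j < n \<Longrightarrow> B $$ (i, j) = 0"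
begin

text \<open>In the columns from \<open>k\<close> on, only row 0 of \<open>B\<close> can be
  nonzero.\<close>

lemma mult_outer_commutant_index:
  assumes p: "\<And>i. i < k \<Longrightarrow> p i = 0" and ij: "i < n" "j < n"
  shows "(B * outer n p q) $$ (i, j) = (if i = 0 then (\<Sum>l = k..<n. B $$ (0, l) * p l) * q j else 0)"
proof -
  have "(\<Sum>l = 0..<n. B $$ (i, l) * p l) = (\<Sum>l = k..<n. B $$ (i, l) * p l)"
    using p k by (intro sum.mono_neutral_right) auto
  also have "\<dots> = (if i = 0 then (\<Sum>l = k..<n. B $$ (0, l) * p l) else 0)"
    using ij commutant_upper_right[OF B k comm, of i] corner[of i]
    by (cases "i < k") (auto intro!: sum.neutral)
  finally show ?thesis using mult_outer_index[OF B ij] by simp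
qed

text \<open>Dually, in the rows from \<open>k\<close> on, only column \<open>k - 1\<close> of
  \<open>B\<close> can be nonzero.\<close>

lemma outer_mult_commutant_index:
  assumes q: "\<And>i. i < k \<Longrightarrow> q i = 0" and ij: "i < n" "j < n"
  shows "(outer n p q * B) $$ (i, j) =
    (if j = k - 1 then p i * (\<Sum>l = k..<n. q l * B $$ (l, k - 1)) else 0)"
proof -
  have "(\<Sum>l = 0..<n. q l * B $$ (l, j)) = (\<Sum>l = k..<n. q l * B $$ (l, j))"
    using q k by (intro sum.mono_neutral_right) auto
  also have "\<dots> = (if j = k - 1 then (\<Sum>l = k..<n. q l * B $$ (l, k - 1)) else 0)"
    using ij commutant_lower_left[OF B k comm, of _ j] corner[of _ j]
    by (cases "j < k - 1") (auto intro!: sum.neutral)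
  finally show ?thesis using outer_mult_index[OF B ij] by simp
qed

text \<open>The words \<open>Y B^d Y\<close> vanish for \<open>Y = outer n p q\<close>: for
  \<open>d = 0\<close> because \<open>q\<close> is orthogonal to \<open>p\<close>; for
  \<open>d = 1\<close> because \<open>B * Y\<close> lives in row 0, where \<open>q\<close> is zero;
  for larger \<open>d\<close> because column 0 of \<open>B\<close> is zero, hence
  \<open>B * (B * Y) = 0\<close>.\<close>

lemma nilpotent_add_outer:
  assumes p: "\<And>i. i < k \<Longrightarrow> p i = 0" and q: "\<And>i. i < k \<Longrightarrow> q i = 0"
    and qp: "(\<Sum>l = k..<n. q l * p l) = 0"
  shows "nilpotent_mat (B + outer n p q)"
proof (rule nilpotent_mat_add[OF B outer_carrier nil])
  let ?Y = "outer n p q"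
  have BY: "B * ?Y \<in> carrier_mat n n" using B by simp
  have "(\<Sum>l = 0..<n. q l * (p l * q j)) = 0" for j
  proof -
    have "(\<Sum>l = 0..<n. q l * (p l * q j)) = (\<Sum>l = k..<n. q l * (p l * q j))"
      using p k by (intro sum.mono_neutral_right) auto
    also have "\<dots> = (\<Sum>l = k..<n. q l * p l) * q j" by (simp add: sum_distrib_right mult.assoc)
    finally show ?thesis using qp by simp
  qed
  then have YY: "?Y * ?Y = 0\<^sub>m n n"
    by (intro eq_matI) (auto simp: outer_mult_index[of _ n] simp del: index_mult_mat(1), auto simp: outer_def)
  have YBY: "?Y * (B * ?Y) = 0\<^sub>m n n"
  proof (rule eq_matI)
    fix i j assume "i < dim_row (0\<^sub>m n n :: 'a mat)" "j < dim_col (0\<^sub>m n n :: 'a mat)"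
    then have ij: "i < n" "j < n" by auto
    have z: "q l * (B * ?Y) $$ (l, j) = 0" if "l < n" for l
      using mult_outer_commutant_index[OF p that ij(2), where q = q] q[of 0] k by auto
    then show "(?Y * (B * ?Y)) $$ (i, j) = 0\<^sub>m n n $$ (i, j)"
      using ij z unfolding outer_mult_index[OF BY ij] by (simp add: sum.neutral del: mult_eq_0_iff)
  qed (auto simp: outer_def)
  have BBY: "B * (B * ?Y) = 0\<^sub>m n n"
  proof (rule eq_matI)
    fix i j assume "i < dim_row (0\<^sub>m n n :: 'a mat)" "j < dim_col (0\<^sub>m n n :: 'a mat)"
    then have ij: "i < n" "j < n" by auto
    have "B $$ (l, 0) = 0" if "l < n" for l
      using commutant_col_0[OF B k comm] nilpotent_mat_entry_00[OF B _ nil] that k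
      by (cases "l = 0") auto
    then have "B $$ (i, l) * (B * ?Y) $$ (l, j) = 0" if "l < n" for l
      using mult_outer_commutant_index[OF p that ij(2), where q = q] ij by auto
    moreover have "(B * (B * ?Y)) $$ (i, j) = (\<Sum>l = 0..<n. B $$ (i, l) * (B * ?Y) $$ (l, j))"
      by (rule mat_mult_index[OF B BY ij])
    ultimately show "(B * (B * ?Y)) $$ (i, j) = 0\<^sub>m n n $$ (i, j)"
      using ij by (simp add: sum.neutral del: mult_eq_0_iff)
  qed (use B in \<open>auto simp: outer_def\<close>)
  show "?Y * (B ^\<^sub>m d * ?Y) = 0\<^sub>m n n" for d
  proof -
    consider "d = 0" | "d = 1" | e where "d = Suc (Suc e)" by (metis One_nat_def not0_implies_Suc)
    then show ?thesis
    proof cases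
      case 3
      have "B ^\<^sub>m d * ?Y = B ^\<^sub>m e * B * (B * ?Y)" unfolding 3 pow_mat.simps
        using B by (intro assoc_mult_mat[of _ n n _ n _ n]) auto
      also have "\<dots> = B ^\<^sub>m e * (B * (B * ?Y))" using B BY by (intro assoc_mult_mat[of _ n n _ n _ n]) auto
      also have "\<dots> = 0\<^sub>m n n" unfolding BBY using right_mult_zero_mat[OF pow_carrier_mat[OF B]] by simp
      finally show ?thesis using right_mult_zero_mat[OF outer_carrier, of n p q n] by simp
    qed (use B YY YBY left_mult_one_mat[OF outer_carrier, of n p q] in auto)
  qed
qed

end

lemma exists_isotropic_combination:
  fixes a b c :: "'a :: alg_closed_field"
  shows "\<exists>\<alpha> \<beta>. (\<alpha> \<noteq> 0 \<or> \<beta> \<noteq> 0) \<and> a * \<alpha>\<^sup>2 + b * (\<alpha> * \<beta>) + c * \<beta>\<^sup>2 = 0"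
proof (cases "a = 0")
  case True
  then show ?thesis by (intro exI[of _ 1] exI[of _ 0]) simp
next
  case False
  then have "degree [:c, b, a:] > 0" by simp
  then obtain x where "poly [:c, b, a:] x = 0" using alg_closed_imp_poly_has_root by blast
  then show ?thesis by (intro exI[of _ x] exI[of _ 1]) (simp add: algebra_simps power2_eq_square)
qed

text \<open>If \<open>u\<close> is nonzero on the index range, take \<open>q = u\<close> and
  \<open>p\<close> orthogonal to \<open>u\<close>; if \<open>w\<close> is nonzero, take
  \<open>p = w\<close> and \<open>q\<close> orthogonal to \<open>w\<close>; the assumption supplies
  the remaining orthogonality. If both vanish, two distinct unit vectors do.\<close>

lemma exists_square_zero_rank_one:
  fixes u w :: "nat \<Rightarrow> 'a :: idom"
  assumes kn: "k + 2 \<le> n" and uw: "(\<Sum>l = k..<n. u l * w l) = 0"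
  shows "\<exists>p q. (\<forall>i<k. p i = 0) \<and> (\<forall>i<k. q i = 0) \<and> (\<Sum>l = k..<n. u l * p l) = 0 \<and>
    (\<Sum>l = k..<n. q l * w l) = 0 \<and> (\<Sum>l = k..<n. q l * p l) = 0 \<and>
    (\<exists>i\<in>{k..<n}. p i \<noteq> 0) \<and> (\<exists>i\<in>{k..<n}. q i \<noteq> 0)"
proof -
  have perp: "\<exists>p. (\<forall>i<k. p i = 0) \<and> (\<Sum>l = k..<n. v l * p l) = 0 \<and> (\<exists>i\<in>{k..<n}. p i \<noteq> 0)"
    if v: "a \<in> {k..<n}" "v a \<noteq> 0" for v :: "nat \<Rightarrow> 'a" and a
  proof -
    obtain b where b: "b \<in> {k..<n}" "b \<noteq> a" using kn v by (metis atLeastLessThan_iff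
      add_2_eq_Suc' le_less_trans lessI less_SucI less_le_trans less_or_eq_imp_le nat_neq_iff not_less_eq)
    \<comment> \<open>A second index \<open>b\<close> exists since the range has at least two
      elements; the two contributions to the product with \<open>v\<close> cancel.\<close>
    define p where "p i = (if i = a then v b else if i = b then - v a else 0)" for i
    have "(\<Sum>l = k..<n. v l * p l) = (\<Sum>l \<in> {a, b}. v l * p l)"
      using v b by (intro sum.mono_neutral_right) (auto simp: p_def)
    also have "\<dots> = 0" using b by (simp add: p_def)
    finally show ?thesis using v b by (intro exI[of _ p]) (auto simp: p_def intro!: bexI[of _ b])
  qed
  define u' where "u' i = (if i < k then 0 else u i)" for i
  define w' where "w' i = (if i < k then 0 else w i)" for i
  have u'[simp]: "(\<Sum>l = k..<n. u' l * f l) = (\<Sum>l = k..<n. u l * f l)" for f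
    by (intro sum.cong) (auto simp: u'_def)
  have w'[simp]: "(\<Sum>l = k..<n. f l * w' l) = (\<Sum>l = k..<n. f l * w l)" for f
    by (intro sum.cong) (auto simp: w'_def)
  consider a where "a \<in> {k..<n}" "u a \<noteq> 0" | a where "a \<in> {k..<n}" "w a \<noteq> 0"
    | "\<And>a. a \<in> {k..<n} \<Longrightarrow> u a = 0" "\<And>a. a \<in> {k..<n} \<Longrightarrow> w a = 0" by blast
  then show ?thesis
  proof cases
    case 1
    then obtain p where p: "\<forall>i<k. p i = 0" "(\<Sum>l = k..<n. u l * p l) = 0" "\<exists>i\<in>{k..<n}. p i \<noteq> 0"
      using perp[of a u] by blast
    show ?thesis
      by (rule exI[of _ p], rule exI[of _ u']) (use p uw 1 in \<open>auto simp: u'_def[symmetric]\<close>, auto simp: u'_def)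
  next
    case 2
    then obtain q where q: "\<forall>i<k. q i = 0" "(\<Sum>l = k..<n. w l * q l) = 0" "\<exists>i\<in>{k..<n}. q i \<noteq> 0"
      using perp[of a w] by blast
    show ?thesis
      by (rule exI[of _ w'], rule exI[of _ q]) (use q uw 2 in \<open>auto simp: mult.commute[of "q _"]\<close>, auto simp: w'_def)
  next
    case 3
    define e where "e a i = (if i = a then 1 else 0 :: 'a)" for a i :: nat
    show ?thesis
      by (rule exI[of _ "e k"], rule exI[of _ "e (k + 1)"])
        (use 3 kn in \<open>auto simp: e_def intro!: sum.neutral bexI[of _ k] bexI[of _ "Suc k"]\<close>)
  qed
qed

lemma span3_first:
  assumes "X \<in> carrier_mat n n" "Y \<in> carrier_mat n n" "Z \<in> carrier_mat n n"
  shows "X \<in> span3 X Y (Z :: 'a :: comm_ring_1 mat)"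
proof -
  have "X = 1 \<cdot>\<^sub>m X + 0 \<cdot>\<^sub>m Y + 0 \<cdot>\<^sub>m Z" using assms by (intro eq_matI) auto
  then show ?thesis unfolding span3_def by blast
qed

lemma corner_nonzero_imp_has_minor:
  fixes B C :: "'a :: alg_closed_field mat"
  assumes B: "B \<in> carrier_mat n n" and C: "C \<in> carrier_mat n n" and k: "0 < k"
    and ij: "k \<le> i" "i < n" "k \<le> j" "j < n" and nz: "B $$ (i, j) \<noteq> 0 \<or> C $$ (i, j) \<noteq> 0"
  shows "\<exists>M \<in> span3 (jordan_part n k) B C. has_minor k n M"
proof (cases "B $$ (i, j) = 0")
  case False
  then obtain s where s: "has_minor k n (jordan_part n k + s \<cdot>\<^sub>m B)"
    using jordan_part_pencil_has_minor[OF B k] ij by blast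
  have "jordan_part n k + s \<cdot>\<^sub>m B = 1 \<cdot>\<^sub>m jordan_part n k + s \<cdot>\<^sub>m B + 0 \<cdot>\<^sub>m C"
    using B C by (intro eq_matI) (auto simp: jordan_part_def)
  then show ?thesis using s unfolding span3_def by auto
next
  case True
  then obtain s where s: "has_minor k n (jordan_part n k + s \<cdot>\<^sub>m C)"
    using jordan_part_pencil_has_minor[OF C k] ij nz by blast
  have "jordan_part n k + s \<cdot>\<^sub>m C = 1 \<cdot>\<^sub>m jordan_part n k + 0 \<cdot>\<^sub>m B + s \<cdot>\<^sub>m C"
    using B C by (intro eq_matI) (auto simp: jordan_part_def)
  then show ?thesis using s unfolding span3_def by auto
qed

lemma N3_I:
  assumes "X \<in> carrier_mat n n" "Y \<in> carrier_mat n n" "Z \<in> carrier_mat n n"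
    "nilpotent_mat X" "nilpotent_mat Y" "nilpotent_mat Z" "X * Y = Y * X" "X * Z = Z * X" "Y * Z = Z * Y"
  shows "(X, Y, Z) \<in> N3 n"
  using assms by (simp add: N3_def carrier_mat3_def)

lemma nilpotent_jordan_part: "nilpotent_mat (jordan_part n k :: 'a :: comm_ring_1 mat)"
  by (rule nilpotent_mat_strict_upper[of _ n]) (auto simp: jordan_part_def)

lemma outer_smult: "c \<cdot>\<^sub>m outer n p q = outer n (\<lambda>i. c * p i) q"
  by (rule eq_matI) (auto simp: outer_def)

text \<open>The terms in \<open>Y * Y\<close> agree on both sides, so beyond
  \<open>B * C = C * B\<close> only the terms linear in \<open>Y\<close> must be compared;
  \<open>eq\<close> does this.\<close>

lemma commute_add_outer:
  fixes B C Y :: "'a :: comm_ring_1 mat"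
  assumes [simp]: "B \<in> carrier_mat n n" "C \<in> carrier_mat n n" "Y \<in> carrier_mat n n"
    and BC: "B * C = C * B"
    and eq: "b \<cdot>\<^sub>m (B * Y) + a \<cdot>\<^sub>m (Y * C) = a \<cdot>\<^sub>m (C * Y) + b \<cdot>\<^sub>m (Y * B)"
  shows "(B + a \<cdot>\<^sub>m Y) * (C + b \<cdot>\<^sub>m Y) = (C + b \<cdot>\<^sub>m Y) * (B + a \<cdot>\<^sub>m Y)"
proof -
  have regroup: "P + c \<cdot>\<^sub>m Q + (d \<cdot>\<^sub>m R + e \<cdot>\<^sub>m Z) = P + (d \<cdot>\<^sub>m R + c \<cdot>\<^sub>m Q) + e \<cdot>\<^sub>m Z"
    if "P \<in> carrier_mat n n" "Q \<in> carrier_mat n n" "R \<in> carrier_mat n n" "Z \<in> carrier_mat n n"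
    for P Q R Z :: "'a mat" and c d e
    using that by (intro eq_matI) (auto simp: algebra_simps)
  have expand: "(V + c \<cdot>\<^sub>m Y) * (W + d \<cdot>\<^sub>m Y) = V * W + (d \<cdot>\<^sub>m (V * Y) + c \<cdot>\<^sub>m (Y * W)) + (c * d) \<cdot>\<^sub>m (Y * Y)"
    if [simp]: "V \<in> carrier_mat n n" "W \<in> carrier_mat n n" for V W c d
  proof -
    have c: "V * W \<in> carrier_mat n n" "V * Y \<in> carrier_mat n n" "Y * W \<in> carrier_mat n n" "Y * Y \<in> carrier_mat n n"
      by (rule mult_carrier_mat[of _ n n]; simp)+
    have "(V + c \<cdot>\<^sub>m Y) * (W + d \<cdot>\<^sub>m Y) = (V + c \<cdot>\<^sub>m Y) * W + (V + c \<cdot>\<^sub>m Y) * (d \<cdot>\<^sub>m Y)"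
      by (rule mult_add_distrib_mat[of _ n n _ n]) auto
    also have "(V + c \<cdot>\<^sub>m Y) * W = V * W + c \<cdot>\<^sub>m (Y * W)"
      by (simp add: add_mult_distrib_mat[of _ n n _ _ n] mult_smult_assoc_mat[of _ n n _ n])
    also have "(V + c \<cdot>\<^sub>m Y) * (d \<cdot>\<^sub>m Y) = d \<cdot>\<^sub>m (V * Y) + (c * d) \<cdot>\<^sub>m (Y * Y)"
    proof -
      have "(V + c \<cdot>\<^sub>m Y) * (d \<cdot>\<^sub>m Y) = V * (d \<cdot>\<^sub>m Y) + c \<cdot>\<^sub>m Y * (d \<cdot>\<^sub>m Y)"
        by (rule add_mult_distrib_mat[of _ n n _ _ n]) auto
      also have "c \<cdot>\<^sub>m Y * (d \<cdot>\<^sub>m Y) = c \<cdot>\<^sub>m (Y * (d \<cdot>\<^sub>m Y))"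
        by (rule mult_smult_assoc_mat[of _ n n _ n]) auto
      also have "Y * (d \<cdot>\<^sub>m Y) = d \<cdot>\<^sub>m (Y * Y)"
        by (rule mult_smult_distrib[of _ n n _ n]) auto
      also have "V * (d \<cdot>\<^sub>m Y) = d \<cdot>\<^sub>m (V * Y)"
        by (rule mult_smult_distrib[of _ n n _ n]) auto
      also have "c \<cdot>\<^sub>m (d \<cdot>\<^sub>m (Y * Y)) = (c * d) \<cdot>\<^sub>m (Y * Y)" by (rule eq_matI) (auto simp: mult.assoc)
      finally show ?thesis .
    qed
    also have "V * W + c \<cdot>\<^sub>m (Y * W) + \<dots> = V * W + (d \<cdot>\<^sub>m (V * Y) + c \<cdot>\<^sub>m (Y * W)) + (c * d) \<cdot>\<^sub>m (Y * Y)"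
      using regroup[OF c(1,3,2,4)] by simp
    finally show ?thesis .
  qed
  have "(a * b) \<cdot>\<^sub>m (Y * Y) = (b * a) \<cdot>\<^sub>m (Y * Y)" by (simp add: mult.commute)
  then show ?thesis using BC eq by (simp add: expand)
qed

text \<open>\<open>S\<close> stands for the Zariski closure of \<open>R3 n\<close>, transported by
  the conjugation that puts the first matrix into Jordan form.\<close>

locale perturbation =
  fixes n k :: nat and S :: "'a :: alg_closed_field mat3 set"
  assumes closed: "curve_closed n S" and k: "2 \<le> k" "k < n"
    and has_minor_S: "\<And>X Y Z M. (X, Y, Z) \<in> N3 n \<Longrightarrow> M \<in> span3 X Y Z \<Longrightarrow> has_minor k n M \<Longrightarrow> (X, Y, Z) \<in> S"
begin

abbreviation "J \<equiv> jordan_part n k :: 'a mat"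

lemma two_zero_blocks:
  assumes N: "(J, B, C) \<in> N3 n" and kn: "k + 2 \<le> n"
    and cornerB: "\<And>i j. k \<le> i \<Longrightarrow> i < n \<Longrightarrow> k \<le> j \<Longrightarrow> j < n \<Longrightarrow> B $$ (i, j) = 0"
    and cornerC: "\<And>i j. k \<le> i \<Longrightarrow> i < n \<Longrightarrow> k \<le> j \<Longrightarrow> j < n \<Longrightarrow> C $$ (i, j) = 0"
  shows "(J, B, C) \<in> S"
proof -
  have B: "B \<in> carrier_mat n n" and C: "C \<in> carrier_mat n n"
    and nilB: "nilpotent_mat B" and nilC: "nilpotent_mat C"
    and JB: "J * B = B * J" and JC: "J * C = C * J" and BC: "B * C = C * B"
    using N by (auto simp: N3_def carrier_mat3_def)
  have kn': "k \<le> n" using k by simp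
  let ?u = "\<lambda>l. B $$ (0, l)" and ?w = "\<lambda>l. B $$ (l, k - 1)"
  let ?z = "\<lambda>l. C $$ (0, l)" and ?y = "\<lambda>l. C $$ (l, k - 1)"
  \<comment> \<open>The coefficients are those of
    \<open>(\<beta>u - \<alpha>z) \<cdot> (\<beta>w - \<alpha>y)\<close> as a quadratic form in
    \<open>\<alpha>\<close> and \<open>\<beta>\<close>.\<close>
  obtain \<alpha> \<beta> where \<alpha>\<beta>: "\<alpha> \<noteq> 0 \<or> \<beta> \<noteq> 0" and iso: "(\<Sum>l = k..<n. ?z l * ?y l) * \<alpha>\<^sup>2 +
      (\<Sum>l = k..<n. - (?u l * ?y l + ?z l * ?w l)) * (\<alpha> * \<beta>) + (\<Sum>l = k..<n. ?u l * ?w l) * \<beta>\<^sup>2 = 0"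
    using exists_isotropic_combination by blast
  have "(\<Sum>l = k..<n. (\<beta> * ?u l - \<alpha> * ?z l) * (\<beta> * ?w l - \<alpha> * ?y l)) =
     (\<Sum>l = k..<n. ?z l * ?y l * \<alpha>\<^sup>2 + (- (?u l * ?y l + ?z l * ?w l)) * (\<alpha> * \<beta>) + ?u l * ?w l * \<beta>\<^sup>2)"
    by (rule sum.cong) (auto simp: algebra_simps power2_eq_square)
  also have "\<dots> = 0" using iso by (simp only: sum.distrib sum_distrib_right)
  finally have "(\<Sum>l = k..<n. (\<beta> * ?u l - \<alpha> * ?z l) * (\<beta> * ?w l - \<alpha> * ?y l)) = 0" .
  from exists_square_zero_rank_one[OF kn this] obtain p q
    where p: "\<And>i. i < k \<Longrightarrow> p i = 0" and q: "\<And>i. i < k \<Longrightarrow> q i = 0"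
    and up: "(\<Sum>l = k..<n. (\<beta> * ?u l - \<alpha> * ?z l) * p l) = 0"
    and qw: "(\<Sum>l = k..<n. q l * (\<beta> * ?w l - \<alpha> * ?y l)) = 0"
    and qp: "(\<Sum>l = k..<n. q l * p l) = 0"
    and nz: "\<exists>i\<in>{k..<n}. p i \<noteq> 0" "\<exists>i\<in>{k..<n}. q i \<noteq> 0"
    by blast
  define Y where "Y = outer n p q"
  have Y: "Y \<in> carrier_mat n n" by (simp add: Y_def)
  \<comment> \<open>Both products are zero: \<open>Y\<close> lives in the corner and
    \<open>J\<close> in the complementary block.\<close>
  have YJ: "J * Y = Y * J"
  proof (rule eq_matI)
    fix i j assume "i < dim_row (Y * J)" "j < dim_col (Y * J)"
    then have ij: "i < n" "j < n" by (auto simp: Y_def outer_def jordan_part_def)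
    show "(J * Y) $$ (i, j) = (Y * J) $$ (i, j)"
      unfolding jordan_part_mult_index[OF Y ij kn'] mult_jordan_part_index[OF Y ij]
      using p[of "Suc i"] q[of "j - 1"] ij k less_imp_diff_less[of j k 1] by (auto simp: Y_def outer_def)
  qed (auto simp: Y_def outer_def jordan_part_def)
  have J_add: "J * (W + c \<cdot>\<^sub>m Y) = (W + c \<cdot>\<^sub>m Y) * J" if "W \<in> carrier_mat n n" "J * W = W * J" for W c
    using that Y YJ
    by (simp add: mult_add_distrib_mat[of _ n n _ n] add_mult_distrib_mat[of _ n n _ _ n]
      mult_smult_distrib[of _ n n _ n] mult_smult_assoc_mat[of _ n n _ n])
  have nil: "nilpotent_mat (W + c \<cdot>\<^sub>m Y)"
    if W: "W \<in> carrier_mat n n" "J * W = W * J" "nilpotent_mat W"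
      "\<And>i j. k \<le> i \<Longrightarrow> i < n \<Longrightarrow> k \<le> j \<Longrightarrow> j < n \<Longrightarrow> W $$ (i, j) = 0" for W c
    unfolding Y_def outer_smult
  proof (rule nilpotent_add_outer[OF W(1) k(1) kn' W(2,3,4)])
    have "(\<Sum>l = k..<n. q l * (c * p l)) = c * (\<Sum>l = k..<n. q l * p l)"
      by (simp add: sum_distrib_left mult.left_commute)
    then show "(\<Sum>l = k..<n. q l * (c * p l)) = 0" using qp by simp
  qed (use p q in auto)
  have up': "\<beta> * (\<Sum>l = k..<n. ?u l * p l) = \<alpha> * (\<Sum>l = k..<n. ?z l * p l)"
  proof -
    have "\<beta> * (\<Sum>l = k..<n. ?u l * p l) - \<alpha> * (\<Sum>l = k..<n. ?z l * p l)
      = (\<Sum>l = k..<n. (\<beta> * ?u l - \<alpha> * ?z l) * p l)"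
      by (simp add: sum_distrib_left sum_subtractf algebra_simps)
    then show ?thesis using up by simp
  qed
  have qw': "\<beta> * (\<Sum>l = k..<n. q l * ?w l) = \<alpha> * (\<Sum>l = k..<n. q l * ?y l)"
  proof -
    have "\<beta> * (\<Sum>l = k..<n. q l * ?w l) - \<alpha> * (\<Sum>l = k..<n. q l * ?y l)
      = (\<Sum>l = k..<n. q l * (\<beta> * ?w l - \<alpha> * ?y l))"
      by (simp add: sum_distrib_left sum_subtractf algebra_simps)
    then show ?thesis using qw by simp
  qed
  have WY: "(W * Y) $$ (i, j) = (if i = 0 then (\<Sum>l = k..<n. W $$ (0, l) * p l) * q j else 0)"
    and YW: "(Y * W) $$ (i, j) = (if j = k - 1 then p i * (\<Sum>l = k..<n. q l * W $$ (l, k - 1)) else 0)"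
    if W: "W \<in> carrier_mat n n" "J * W = W * J" "nilpotent_mat W"
      "\<And>i j. k \<le> i \<Longrightarrow> i < n \<Longrightarrow> k \<le> j \<Longrightarrow> j < n \<Longrightarrow> W $$ (i, j) = 0" and ij: "i < n" "j < n" for W i j
    unfolding Y_def by (rule mult_outer_commutant_index[OF W(1) k(1) kn' W(2-4) p ij]
        outer_mult_commutant_index[OF W(1) k(1) kn' W(2-4) q ij]; assumption)+
  \<comment> \<open>The choice of \<open>p\<close> gives \<open>\<beta> B Y = \<alpha> C Y\<close>,
    and that of \<open>q\<close> gives \<open>\<beta> Y B = \<alpha> Y C\<close>.\<close>
  have eq: "(t * \<beta>) \<cdot>\<^sub>m (B * Y) + (t * \<alpha>) \<cdot>\<^sub>m (Y * C) = (t * \<alpha>) \<cdot>\<^sub>m (C * Y) + (t * \<beta>) \<cdot>\<^sub>m (Y * B)" for t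
  proof (rule eq_matI)
    fix i j assume "i < dim_row ((t * \<alpha>) \<cdot>\<^sub>m (C * Y) + (t * \<beta>) \<cdot>\<^sub>m (Y * B))"
      "j < dim_col ((t * \<alpha>) \<cdot>\<^sub>m (C * Y) + (t * \<beta>) \<cdot>\<^sub>m (Y * B))"
    then have ij: "i < n" "j < n" using B Y by auto
    note BY = WY[OF B JB nilB _ ij, OF cornerB] and CY = WY[OF C JC nilC _ ij, OF cornerC]
      and YB = YW[OF B JB nilB _ ij, OF cornerB] and YC = YW[OF C JC nilC _ ij, OF cornerC]
    have 1: "t * \<beta> * (B * Y) $$ (i, j) = t * \<alpha> * (C * Y) $$ (i, j)"
      using arg_cong[OF up', of "\<lambda>x. t * x * q j"] BY CY by (simp add: mult.assoc)
    have 2: "t * \<beta> * (Y * B) $$ (i, j) = t * \<alpha> * (Y * C) $$ (i, j)"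
      using arg_cong[OF qw', of "\<lambda>x. t * x * p i"] YB YC by (simp add: algebra_simps)
    show "((t * \<beta>) \<cdot>\<^sub>m (B * Y) + (t * \<alpha>) \<cdot>\<^sub>m (Y * C)) $$ (i, j) =
        ((t * \<alpha>) \<cdot>\<^sub>m (C * Y) + (t * \<beta>) \<cdot>\<^sub>m (Y * B)) $$ (i, j)"
    proof -
      have "((t * \<beta>) \<cdot>\<^sub>m (B * Y) + (t * \<alpha>) \<cdot>\<^sub>m (Y * C)) $$ (i, j) =
          t * \<beta> * (B * Y) $$ (i, j) + t * \<alpha> * (Y * C) $$ (i, j)"
        using ij B C Y by (simp del: index_mult_mat(1))
      also have "\<dots> = ((t * \<alpha>) \<cdot>\<^sub>m (C * Y) + (t * \<beta>) \<cdot>\<^sub>m (Y * B)) $$ (i, j)"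
        unfolding 1 2[symmetric] using ij B C Y by (simp del: index_mult_mat(1))
      finally show ?thesis .
    qed
  qed (use B C Y in auto)
  have "(J, B + (t * \<alpha>) \<cdot>\<^sub>m Y, C + (t * \<beta>) \<cdot>\<^sub>m Y) \<in> S" if t: "t \<noteq> 0" for t
  proof -
    have nil': "nilpotent_mat (B + (t * \<alpha>) \<cdot>\<^sub>m Y)" "nilpotent_mat (C + (t * \<beta>) \<cdot>\<^sub>m Y)"
      by (rule nil; fact)+
    have "(J, B + (t * \<alpha>) \<cdot>\<^sub>m Y, C + (t * \<beta>) \<cdot>\<^sub>m Y) \<in> N3 n"
      by (rule N3_I[OF _ _ _ nilpotent_jordan_part nil' J_add[OF B JB] J_add[OF C JC]
            commute_add_outer[OF B C Y BC eq]]) (use B C Y in auto)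
    moreover obtain i j where ij: "k \<le> i" "i < n" "k \<le> j" "j < n" "p i \<noteq> 0" "q j \<noteq> 0" using nz by auto
    \<comment> \<open>Both original corners are zero, so these entries are
      \<open>t * \<alpha> * p i * q j\<close> and \<open>t * \<beta> * p i * q j\<close>, not both
      zero.\<close>
    have "(B + (t * \<alpha>) \<cdot>\<^sub>m Y) $$ (i, j) \<noteq> 0 \<or> (C + (t * \<beta>) \<cdot>\<^sub>m Y) $$ (i, j) \<noteq> 0"
      using ij \<alpha>\<beta> t B C Y cornerB[OF ij(1-4)] cornerC[OF ij(1-4)] by (auto simp: Y_def outer_def)
    then have "\<exists>M \<in> span3 J (B + (t * \<alpha>) \<cdot>\<^sub>m Y) (C + (t * \<beta>) \<cdot>\<^sub>m Y). has_minor k n M"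
      using ij k B C Y by (intro corner_nonzero_imp_has_minor[where i = i and j = j]) auto
    ultimately show ?thesis using has_minor_S by blast
  qed
  then have "(J, B + (0 * \<alpha>) \<cdot>\<^sub>m Y, C + (0 * \<beta>) \<cdot>\<^sub>m Y) \<in> S"
    using B C Y by (intro curve_closedD[OF closed, where A = "\<lambda>_. J" and B = "\<lambda>t. B + (t * \<alpha>) \<cdot>\<^sub>m Y"
          and C = "\<lambda>t. C + (t * \<beta>) \<cdot>\<^sub>m Y"] mat_curve_const mat_curve_add mat_curve_smult
          poly_fun_mult poly_fun_id poly_fun_const) auto
  moreover have "B + 0 \<cdot>\<^sub>m Y = B" "C + 0 \<cdot>\<^sub>m Y = C" using B C Y by (auto intro!: eq_matI)
  ultimately show ?thesis by simp
qed

end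

subsection \<open>One zero block\<close>

lemma toeplitz_add: "toeplitz n f + toeplitz n g = toeplitz n (\<lambda>d. f d + g d :: 'a :: monoid_add)"
  by (rule eq_matI) (auto simp: toeplitz_def)

lemma toeplitz_smult: "c \<cdot>\<^sub>m toeplitz n f = toeplitz n (\<lambda>d. c * f d :: 'a :: comm_ring_1)"
  by (rule eq_matI) (auto simp: toeplitz_def)

text \<open>The transposed matrices of multiplication by \<open>x\<close> and \<open>y\<close> on \<open>F[x]/(x\<^sup>k\<^sup>+\<^sup>1)\<close> in the basis
  \<open>1, x, \<dots>, x\<^sup>k\<^sup>-\<^sup>1, y\<close>, provided that \<open>h d = e\<^sup>k\<close> and \<open>d\<^sup>2 = - s e\<^sup>k\<^sup>-\<^sup>1\<close>; \<open>deform_basis\<close> is the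
  transposed change of basis to the powers of \<open>x\<close>. Keeping \<open>h\<close> and \<open>s\<close> as parameters
  avoids denominators.\<close>

definition deform_shift :: "nat \<Rightarrow> 'a \<Rightarrow> 'a \<Rightarrow> 'a \<Rightarrow> 'a :: comm_ring_1 mat" where
  "deform_shift k e d h = mat (Suc k) (Suc k) (\<lambda>(i, j).
     if i < k then
       if j < k then (if j = Suc i then 1 else 0) - (if i = k - 1 \<and> 1 \<le> j then e ^ (k - j) else 0)
       else if i = k - 1 then h else 0
     else if j < k then if j = 1 then - d else 0
     else e)"

definition deform_cross :: "nat \<Rightarrow> 'a \<Rightarrow> 'a \<Rightarrow> 'a \<Rightarrow> 'a :: comm_ring_1 mat" where
  "deform_cross k e d s = mat (Suc k) (Suc k) (\<lambda>(i, j).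
     if i < k then
       if j < k then if 1 \<le> j \<and> j \<le> i then - d * e ^ (i - j) else 0
       else e ^ i
     else if j < k then if 1 \<le> j then s * of_nat (k - j) * e ^ (k - 1 - j) else 0
     else of_nat (k - 1) * d)"

definition deform_basis :: "nat \<Rightarrow> 'a \<Rightarrow> 'a \<Rightarrow> 'a :: field mat" where
  "deform_basis k e d = mat (Suc k) (Suc k) (\<lambda>(i, j).
     if i < k then if i = j then 1 else 0 else if 1 \<le> j then d / e ^ j else 0)"

lemma deform_basis_carrier [simp]: "deform_basis k e d \<in> carrier_mat (Suc k) (Suc k)"
  by (simp add: deform_basis_def)

lemma mult_deform_basis_index:
  fixes X :: "'a :: field mat"
  assumes X: "X \<in> carrier_mat (Suc k) (Suc k)" and ij: "i < Suc k" "j < Suc k"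
  shows "(X * deform_basis k e d) $$ (i, j) =
    (if j < k then X $$ (i, j) else 0) + X $$ (i, k) * (if 1 \<le> j then d / e ^ j else 0)"
proof -
  have "(X * deform_basis k e d) $$ (i, j) =
      (\<Sum>l = 0..<k. X $$ (i, l) * deform_basis k e d $$ (l, j)) + X $$ (i, k) * deform_basis k e d $$ (k, j)"
    using mat_mult_index[OF X deform_basis_carrier ij, of e d] by simp
  also have "(\<Sum>l = 0..<k. X $$ (i, l) * deform_basis k e d $$ (l, j)) =
      (\<Sum>l = 0..<k. if l = j then X $$ (i, j) else 0)"
    using ij by (intro sum.cong) (auto simp: deform_basis_def)
  also have "\<dots> = (if j < k then X $$ (i, j) else 0)" by simp
  finally show ?thesis using ij by (simp add: deform_basis_def)
qed

lemma deform_basis_mult_index: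
  fixes X :: "'a :: field mat"
  assumes X: "X \<in> carrier_mat (Suc k) (Suc k)" and ij: "i < Suc k" "j < Suc k"
  shows "(deform_basis k e d * X) $$ (i, j) =
    (if i < k then X $$ (i, j) else (\<Sum>l = 1..k. d / e ^ l * X $$ (l, j)))"
proof (cases "i < k")
  case True
  have "(deform_basis k e d * X) $$ (i, j) = (\<Sum>l = 0..<Suc k. if l = i then X $$ (i, j) else 0)"
    unfolding mat_mult_index[OF deform_basis_carrier X ij] using True
    by (intro sum.cong) (auto simp: deform_basis_def)
  then show ?thesis using True by simp
next
  case False
  have "(deform_basis k e d * X) $$ (i, j) =
      (\<Sum>l = 0..<Suc k. (if 1 \<le> l then d / e ^ l else 0) * X $$ (l, j))"
    unfolding mat_mult_index[OF deform_basis_carrier X ij] using False ij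
    by (intro sum.cong) (auto simp: deform_basis_def)
  also have "\<dots> = (\<Sum>l = 1..k. (if 1 \<le> l then d / e ^ l else 0) * X $$ (l, j))"
    by (intro sum.mono_neutral_right) auto
  also have "\<dots> = (\<Sum>l = 1..k. d / e ^ l * X $$ (l, j))" by (intro sum.cong) auto
  finally show ?thesis using False by simp
qed

lemma deform_basis_invertible:
  assumes "e \<noteq> 0" "d \<noteq> 0" "0 < k"
  obtains Q' where "Q' \<in> carrier_mat (Suc k) (Suc k)" "deform_basis k e d * Q' = 1\<^sub>m (Suc k)"
    "Q' * deform_basis k e d = (1\<^sub>m (Suc k) :: 'a :: field mat)"
proof -
  \<comment> \<open>Row \<open>i\<close> expresses \<open>x^i\<close> in the basis
    \<open>1, x, ..., x^(k-1), y\<close>; the last row is the definition of \<open>y\<close> solved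
    for \<open>x^k\<close>.\<close>
  define Q' :: "'a mat" where "Q' = mat (Suc k) (Suc k) (\<lambda>(i, j).
     if i < k then if i = j then 1 else 0
     else if j < k then if 1 \<le> j then - (e ^ k / e ^ j) else 0 else e ^ k / d)"
  have Q': "Q' \<in> carrier_mat (Suc k) (Suc k)" by (simp add: Q'_def)
  have "Q' * deform_basis k e d = 1\<^sub>m (Suc k)"
  proof (rule eq_matI)
    fix i j assume "i < dim_row (1\<^sub>m (Suc k) :: 'a mat)" "j < dim_col (1\<^sub>m (Suc k) :: 'a mat)"
    then have ij: "i < Suc k" "j < Suc k" by auto
    show "(Q' * deform_basis k e d) $$ (i, j) = 1\<^sub>m (Suc k) $$ (i, j)"
    proof (cases "j < k")
      case True
      then show ?thesis unfolding mult_deform_basis_index[OF Q' ij] using ij assms by (auto simp: Q'_def)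
    next
      case False
      then have "j = k" using ij by simp
      then show ?thesis unfolding mult_deform_basis_index[OF Q' ij] using ij assms
        by (auto simp: Q'_def)
    qed
  qed (auto simp: Q'_def deform_basis_def)
  then show thesis
    using that[OF Q'] mat_mult_left_right_inverse[OF Q' deform_basis_carrier] by blast
qed

text \<open>Row \<open>i\<close> of either side lists the coefficients of \<open>x\<close> times the
  \<open>i\<close>-th basis element. The two relations behind it are
  \<open>x^k = h y - (e^(k-1) x + ... + e x^(k-1))\<close> and \<open>x y = e y - d x\<close>, the
  latter because \<open>x^(k+1) = 0\<close>.\<close>

lemma deform_shift_intertwine:
  fixes e d h :: "'a :: field"
  assumes e: "e \<noteq> 0" and d: "d \<noteq> 0" and h: "h * d = e ^ k" and k: "2 \<le> k"
  shows "deform_shift k e d h * deform_basis k e d = deform_basis k e d * jordan_part (Suc k) (Suc k)"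
proof (rule eq_matI)
  have A: "deform_shift k e d h \<in> carrier_mat (Suc k) (Suc k)" by (simp add: deform_shift_def)
  fix i j assume "i < dim_row (deform_basis k e d * jordan_part (Suc k) (Suc k))"
    "j < dim_col (deform_basis k e d * jordan_part (Suc k) (Suc k))"
  then have ij: "i < Suc k" "j < Suc k" by (auto simp: deform_basis_def jordan_part_def)
  have h': "h = e ^ k / d" using h d by (simp add: field_simps)
  have pow: "e ^ (k - j) = e ^ k / e ^ j" using ij e by (simp add: power_diff)
  have ek: "e * (d / e ^ j) = d / e ^ (j - 1)" if "1 \<le> j" using that e by (cases j) auto
  show "(deform_shift k e d h * deform_basis k e d) $$ (i, j) =
      (deform_basis k e d * jordan_part (Suc k) (Suc k)) $$ (i, j)"
  proof (cases "j = k")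
    case True
    then show ?thesis
      unfolding mult_deform_basis_index[OF A ij] mult_jordan_part_index[OF deform_basis_carrier ij]
      using ij k e d ek
      by (cases "i < k"; cases "i = k - 1") (auto simp: deform_shift_def deform_basis_def h')
  next
    case False
    then have j: "j < k" using ij by simp
    have e1: "e ^ (k - 1) = e ^ k / e" using k e by (simp add: power_diff)
    show ?thesis
      unfolding mult_deform_basis_index[OF A ij] mult_jordan_part_index[OF deform_basis_carrier ij]
      using ij k e d ek j e1
      by (cases "i < k"; cases "j = 0"; cases "j = 1"; cases "i = k - 1")
        (auto simp: deform_shift_def deform_basis_def h' pow)
  qed
qed (auto simp: deform_shift_def deform_basis_def jordan_part_def)

text \<open>The same for multiplication by \<open>y\<close>. For \<open>i < k\<close> one has
  \<open>x^i y = e^i y - d (e^(i-1) x + ... + x^i)\<close>. In \<open>y y\<close> the coefficient of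
  \<open>x^j\<close> is \<open>(j - 1) d^2 / e^j\<close>; subtracting \<open>(k - 1) d y\<close>
  removes \<open>x^k\<close> and leaves \<open>- (k - j) d^2 / e^j\<close>, which is
  \<open>s (k - j) e^(k-1-j)\<close>.\<close>

lemma deform_cross_intertwine:
  fixes e d s :: "'a :: field"
  assumes e: "e \<noteq> 0" and d: "d * d = - s * e ^ (k - 1)" and k: "2 \<le> k"
  shows "deform_cross k e d s * deform_basis k e d = deform_basis k e d * toeplitz (Suc k) (\<lambda>l. d / e ^ l)"
proof (rule eq_matI)
  have A: "deform_cross k e d s \<in> carrier_mat (Suc k) (Suc k)" by (simp add: deform_cross_def)
  fix i j assume "i < dim_row (deform_basis k e d * toeplitz (Suc k) (\<lambda>l. d / e ^ l))"
    "j < dim_col (deform_basis k e d * toeplitz (Suc k) (\<lambda>l. d / e ^ l))"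
  then have ij: "i < Suc k" "j < Suc k" by (auto simp: deform_basis_def toeplitz_def)
  show "(deform_cross k e d s * deform_basis k e d) $$ (i, j) =
      (deform_basis k e d * toeplitz (Suc k) (\<lambda>l. d / e ^ l)) $$ (i, j)"
  proof (cases "i < k")
    case True
    have "e ^ i * (d / e ^ j) = d * e ^ (i - j)" if "j \<le> i"
      using that e by (simp add: power_diff)
    moreover have "e ^ i * (d / e ^ j) = d / e ^ (j - i)" if "i \<le> j"
      using that e by (simp add: power_diff)
    ultimately show ?thesis
      unfolding mult_deform_basis_index[OF A ij] deform_basis_mult_index[OF toeplitz_carrier ij]
      using True ij by (auto simp: deform_cross_def toeplitz_def not_le)
  next
    case False
    then have i: "i = k" using ij by simp
    have "(\<Sum>l = 1..k. d / e ^ l * toeplitz (Suc k) (\<lambda>l. d / e ^ l) $$ (l, j)) =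
        (\<Sum>l = 1..k. if l \<in> {1..<j} then d * d / e ^ j else 0)"
    proof (rule sum.cong[OF refl])
      fix l assume l: "l \<in> {1..k}"
      have "e ^ l * e ^ (j - l) = e ^ j" if "l < j" using that by (simp flip: power_add)
      then have "e ^ (j - l) * e ^ l = e ^ j" if "l < j" using that by (simp add: mult.commute)
      then show "d / e ^ l * toeplitz (Suc k) (\<lambda>l. d / e ^ l) $$ (l, j) =
          (if l \<in> {1..<j} then d * d / e ^ j else 0)"
        using l ij by (auto simp: toeplitz_def)
    qed
    also have "\<dots> = (\<Sum>l \<in> {1..<j}. d * d / e ^ j)"
      using ij by (intro sum.mono_neutral_cong_right) auto
    also have "\<dots> = of_nat (j - 1) * (d * d / e ^ j)" by simp
    finally have R: "(\<Sum>l = 1..k. d / e ^ l * toeplitz (Suc k) (\<lambda>l. d / e ^ l) $$ (l, j)) =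
        of_nat (j - 1) * (d * d / e ^ j)" .
    show ?thesis
    proof (cases "1 \<le> j \<and> j < k")
      case True
      have "d * d / e ^ j = - s * e ^ (k - 1 - j)"
        using True e d by (simp add: power_diff)
      moreover have "of_nat (k - j) = of_nat (k - 1) - (of_nat (j - 1) :: 'a)"
      proof -
        have "k - 1 = (k - j) + (j - 1)" using True by simp
        then have "of_nat (k - 1) = of_nat (k - j) + (of_nat (j - 1) :: 'a)" by (metis of_nat_add)
        then show ?thesis by simp
      qed
      moreover have "of_nat (k - 1) * d * (d / e ^ j) = of_nat (k - 1) * (d * d / e ^ j)" by simp
      ultimately have "s * of_nat (k - j) * e ^ (k - 1 - j) + of_nat (k - 1) * d * (d / e ^ j)
          = of_nat (j - 1) * (d * d / e ^ j)"
        by (simp only:) (simp add: algebra_simps)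
      then show ?thesis
        unfolding mult_deform_basis_index[OF A ij] deform_basis_mult_index[OF toeplitz_carrier ij] R
        using True i by (simp add: deform_cross_def)
    next
      case False
      then have "j = 0 \<or> j = k" using ij by auto
      then show ?thesis
        unfolding mult_deform_basis_index[OF A ij] deform_basis_mult_index[OF toeplitz_carrier ij] R
        using i k by (auto simp: deform_cross_def)
    qed
  qed
qed (auto simp: deform_cross_def deform_basis_def toeplitz_def)

text \<open>For \<open>n = k + 1\<close> and zero corner, this is what a matrix in the commutant has
  outside its Toeplitz block; \<open>cross k 1 s\<close> is the limit of
  \<open>deform_cross\<close>.\<close>

definition cross :: "nat \<Rightarrow> 'a \<Rightarrow> 'a \<Rightarrow> 'a :: zero mat" where
  "cross k r s = mat (Suc k) (Suc k) (\<lambda>(i, j).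
     if i = 0 \<and> j = k then r else if i = k \<and> j = k - 1 then s else 0)"

lemma has_minor_jordan_part_self: "has_minor k (Suc k) (jordan_part (Suc k) (Suc k) :: 'a :: field mat)"
proof (rule has_minorI[where f = "\<lambda>a. a" and g = Suc and c = "\<lambda>_. 1"])
  have "mat k k (\<lambda>(a, b). jordan_part (Suc k) (Suc k) $$ (a, Suc b) * 1) = (1\<^sub>m k :: 'a mat)"
    by (rule eq_matI) (auto simp: jordan_part_def)
  then show "det (mat k k (\<lambda>(a, b). jordan_part (Suc k) (Suc k) $$ (a, Suc b) * (1 :: 'a))) \<noteq> 0"
    by simp
qed auto

text \<open>The pairs \<open>(u, w)\<close> and \<open>(z, y)\<close> have determinant zero, so they
  lie on a common line, spanned by \<open>(r, s)\<close>.\<close>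

lemma proportional_pairs:
  fixes u w z y :: "'a :: field"
  assumes det: "u * y = z * w"
  obtains a b r s where "u = a * r" "w = a * s" "z = b * r" "y = b * s"
proof (cases "u = 0")
  case u: True
  show thesis
  proof (cases "w = 0")
    case True
    then show thesis using that[of 0 z y 1] u by simp
  next
    case False
    then have "z = 0" using det u by simp
    then show thesis using that[of 1 u w "y / w"] u False by simp
  qed
next
  case False
  then have "y = z / u * w" using det by (simp add: field_simps)
  then show thesis using that[of 1 u w "z / u"] False by simp
qed

section \<open>Limits of triples of multiplications in a truncated polynomial ring\<close>

context perturbation
begin

text \<open>One basis change turns all three matrices into Toeplitz matrices, so they commute and
  are nilpotent. The first becomes a full Jordan block of order \<open>k + 1\<close>, which has rank
  \<open>k\<close>.\<close>

lemma deformed_triple_in_S: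
  fixes e d h s :: 'a
  assumes n: "n = Suc k" and e: "e \<noteq> 0" and d: "d \<noteq> 0" and h: "h * d = e ^ k"
    and dd: "d * d = - s * e ^ (k - 1)"
  defines "A \<equiv> deform_shift k e d h"
  shows "(A, nil_poly bs A + \<alpha> \<cdot>\<^sub>m deform_cross k e d s, nil_poly cs A + \<beta> \<cdot>\<^sub>m deform_cross k e d s) \<in> S"
proof -
  let ?Q = "deform_basis k e d" and ?E = "deform_cross k e d s"
  let ?N = "jordan_part (Suc k) (Suc k) :: 'a mat"
  have A: "A \<in> carrier_mat (Suc k) (Suc k)" and E: "?E \<in> carrier_mat (Suc k) (Suc k)"
    and Q: "?Q \<in> carrier_mat (Suc k) (Suc k)"
    by (simp_all add: A_def deform_shift_def deform_cross_def)
  obtain Q' where Q': "Q' \<in> carrier_mat (Suc k) (Suc k)" and QQ': "?Q * Q' = 1\<^sub>m (Suc k)"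
    and Q'Q: "Q' * ?Q = 1\<^sub>m (Suc k)"
    using deform_basis_invertible[OF e d, of k] k(1) by auto
  have AQ: "A * ?Q = ?Q * ?N" unfolding A_def by (rule deform_shift_intertwine[OF e d h k(1)])
  have AT: "\<exists>f. A * ?Q = ?Q * toeplitz (Suc k) f" using AQ jordan_part_self[of "Suc k"] by metis
  have BT: "\<exists>f. (nil_poly bs A + c \<cdot>\<^sub>m ?E) * ?Q = ?Q * toeplitz (Suc k) f" for bs c
  proof -
    have "(nil_poly bs A + c \<cdot>\<^sub>m ?E) * ?Q = nil_poly bs A * ?Q + c \<cdot>\<^sub>m ?E * ?Q"
      using A E Q by (intro add_mult_distrib_mat[of _ "Suc k" "Suc k" _ _ "Suc k"]) auto
    also have "nil_poly bs A * ?Q = ?Q * nil_poly bs ?N"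
      by (rule nil_poly_intertwine[OF A _ Q AQ]) simp
    also have "c \<cdot>\<^sub>m ?E * ?Q = ?Q * (c \<cdot>\<^sub>m toeplitz (Suc k) (\<lambda>l. d / e ^ l))"
      using mult_smult_assoc_mat[OF E Q] mult_smult_distrib[OF Q toeplitz_carrier]
        deform_cross_intertwine[OF e dd k(1)] by simp
    also have "?Q * nil_poly bs ?N + \<dots> = ?Q * (nil_poly bs ?N + c \<cdot>\<^sub>m toeplitz (Suc k) (\<lambda>l. d / e ^ l))"
      by (rule mult_add_distrib_mat[of ?Q "Suc k" "Suc k" _ "Suc k", symmetric]) auto
    finally show ?thesis unfolding nil_poly_jordan_part_self toeplitz_smult toeplitz_add by blast
  qed
  define B where "B = nil_poly bs A + \<alpha> \<cdot>\<^sub>m ?E"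
  define C where "C = nil_poly cs A + \<beta> \<cdot>\<^sub>m ?E"
  have B: "B \<in> carrier_mat (Suc k) (Suc k)" and C: "C \<in> carrier_mat (Suc k) (Suc k)"
    using A E by (simp_all add: B_def C_def)
  obtain f g where BQ: "B * ?Q = ?Q * toeplitz (Suc k) f" and CQ: "C * ?Q = ?Q * toeplitz (Suc k) g"
    using BT unfolding B_def C_def by blast
  obtain a where AQ': "A * ?Q = ?Q * toeplitz (Suc k) a" using AT by blast
  note commute = intertwine_commute[OF _ _ toeplitz_carrier toeplitz_carrier Q Q' QQ' _ _ toeplitz_commute]
  note nil = intertwine_nilpotent[OF _ toeplitz_carrier Q Q' QQ' _ nilpotent_toeplitz]
  have "(A, B, C) \<in> N3 n" unfolding n
    by (rule N3_I[OF A B C nil[OF A AQ'] nil[OF B BQ] nil[OF C CQ] commute[OF A B AQ' BQ]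
          commute[OF A C AQ' CQ] commute[OF B C BQ CQ]])
  moreover have "A \<in> span3 A B C" by (rule span3_first[OF A B C])
  moreover have "has_minor k n A"
  proof -
    have "A = ?Q * ?N * Q'"
      using AQ assoc_mult_mat[OF A Q Q'] QQ' A by simp
    then show ?thesis
      unfolding n using has_minor_conj[OF has_minor_jordan_part_self jordan_part_carrier Q Q' Q'Q] by simp
  qed
  ultimately have "(A, B, C) \<in> S" by (rule has_minor_S)
  then show ?thesis by (simp add: B_def C_def)
qed

lemma cross_triple_in_S_nonzero:
  assumes n: "n = Suc k" and s: "s \<noteq> 0"
  shows "(J, nil_poly bs J + \<alpha> \<cdot>\<^sub>m cross k 1 s, nil_poly cs J + \<beta> \<cdot>\<^sub>m cross k 1 s) \<in> S"
proof -
  obtain \<gamma> where \<gamma>: "\<gamma> ^ 2 = - s" using nth_root_exists[of 2 "- s"] by auto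
  then have \<gamma>0: "\<gamma> \<noteq> 0" using s by auto
  \<comment> \<open>With \<open>e = t^2\<close>, the condition \<open>d^2 = - s e^(k-1)\<close> asks
    for \<open>d = \<gamma> t^(k-1)\<close>, and \<open>h = e^k / d\<close> becomes the polynomial
    \<open>t^(k+1) / \<gamma>\<close>.\<close>
  let ?A = "\<lambda>t. deform_shift k (t ^ 2) (\<gamma> * t ^ (k - 1)) (t ^ (k + 1) / \<gamma>)"
  let ?E = "\<lambda>t. deform_cross k (t ^ 2) (\<gamma> * t ^ (k - 1)) s"
  have h: "t ^ (k + 1) / \<gamma> * (\<gamma> * t ^ (k - 1)) = (t ^ 2) ^ k" for t
  proof -
    have "t ^ (k + 1) / \<gamma> * (\<gamma> * t ^ (k - 1)) = t ^ (k + 1) * t ^ (k - 1)" using \<gamma>0 by simp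
    also have "\<dots> = t ^ (k + 1 + (k - 1))" by (simp only: power_add)
    also have "k + 1 + (k - 1) = 2 * k" using k by simp
    finally show ?thesis by (simp only: power_mult)
  qed
  have dd: "\<gamma> * t ^ (k - 1) * (\<gamma> * t ^ (k - 1)) = - s * (t ^ 2) ^ (k - 1)" for t
  proof -
    have "\<gamma> * t ^ (k - 1) * (\<gamma> * t ^ (k - 1)) = \<gamma> ^ 2 * (t ^ 2) ^ (k - 1)"
      by (simp add: power2_eq_square power_mult_distrib ac_simps)
    then show ?thesis unfolding \<gamma> .
  qed
  have cA: "mat_curve n n ?A" and cE: "mat_curve n n ?E"
    unfolding deform_shift_def deform_cross_def n divide_inverse
    by (intro mat_curve_mat poly_fun_if poly_fun_diff poly_fun_mult poly_fun_power poly_fun_uminus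
        poly_fun_const poly_fun_id)+
  have "(?A 0, nil_poly bs (?A 0) + \<alpha> \<cdot>\<^sub>m ?E 0, nil_poly cs (?A 0) + \<beta> \<cdot>\<^sub>m ?E 0) \<in> S"
  proof (rule curve_closedD[OF closed, where A = ?A and B = "\<lambda>t. nil_poly bs (?A t) + \<alpha> \<cdot>\<^sub>m ?E t"
        and C = "\<lambda>t. nil_poly cs (?A t) + \<beta> \<cdot>\<^sub>m ?E t", OF cA])
    show "mat_curve n n (\<lambda>t. nil_poly bs (?A t) + \<alpha> \<cdot>\<^sub>m ?E t)"
      "mat_curve n n (\<lambda>t. nil_poly cs (?A t) + \<beta> \<cdot>\<^sub>m ?E t)"
      by (intro mat_curve_add mat_curve_smult mat_curve_nil_poly cA cE poly_fun_const)+
    show "(?A t, nil_poly bs (?A t) + \<alpha> \<cdot>\<^sub>m ?E t, nil_poly cs (?A t) + \<beta> \<cdot>\<^sub>m ?E t) \<in> S"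
      if "t \<noteq> 0" for t
      by (rule deformed_triple_in_S[OF n _ _ h dd]) (use that \<gamma>0 in auto)
  qed
  moreover have "?A 0 = J"
    using k by (intro eq_matI) (auto simp: deform_shift_def jordan_part_def n power_0_left)
  \<comment> \<open>As \<open>k \<ge> 2\<close>, \<open>d\<close> vanishes at 0. Only zeroth powers
    of \<open>e\<close> survive: the entry 1 at \<open>(0, k)\<close>, and \<open>s\<close> at
    \<open>(k, k - 1)\<close>, where the factor \<open>k - j\<close> equals 1.\<close>
  moreover have "?E 0 = cross k 1 s"
    using k by (intro eq_matI) (auto simp: deform_cross_def cross_def n power_0_left)
  ultimately show ?thesis by simp
qed

text \<open>Three extensions of the case \<open>r = 1\<close>, \<open>s \<noteq> 0\<close>: the
  limit \<open>s \<rightarrow> 0\<close>, then rescaling by \<open>r \<noteq> 0\<close> absorbed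
  into the coefficients, then the limit \<open>r \<rightarrow> 0\<close>.\<close>

lemma cross_triple_in_S:
  assumes n: "n = Suc k"
  shows "(J, nil_poly bs J + \<alpha> \<cdot>\<^sub>m cross k r s, nil_poly cs J + \<beta> \<cdot>\<^sub>m cross k r s) \<in> S"
proof -
  have curve: "mat_curve n n (\<lambda>t. nil_poly as J + c \<cdot>\<^sub>m cross k (f t) (g t))"
    if "poly_fun f" "poly_fun g" for as c f g
    unfolding cross_def using that
    by (intro mat_curve_add mat_curve_smult mat_curve_const nil_poly_carrier jordan_part_carrier poly_fun_const)
      (unfold n, intro mat_curve_mat poly_fun_if poly_fun_const, use that in auto)
  have J: "mat_curve n n (\<lambda>_. J)" by (rule mat_curve_const) simp
  have one: "(J, nil_poly bs J + \<alpha> \<cdot>\<^sub>m cross k 1 s, nil_poly cs J + \<beta> \<cdot>\<^sub>m cross k 1 s) \<in> S" for \<alpha> \<beta> s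
  proof (cases "s = 0")
    case True
    show ?thesis unfolding True
      by (rule curve_closedD[OF closed J curve curve, where f1 = "\<lambda>_. 1" and g1 = "\<lambda>t. t"])
        (auto intro: cross_triple_in_S_nonzero[OF n])
  qed (rule cross_triple_in_S_nonzero[OF n])
  have nz: "(J, nil_poly bs J + \<alpha> \<cdot>\<^sub>m cross k r s, nil_poly cs J + \<beta> \<cdot>\<^sub>m cross k r s) \<in> S"
    if "r \<noteq> 0" for r s
  proof -
    have "c \<cdot>\<^sub>m cross k r s = (c * r) \<cdot>\<^sub>m cross k 1 (s / r)" for c
      using that by (intro eq_matI) (auto simp: cross_def)
    then show ?thesis using one by simp
  qed
  show ?thesis
  proof (cases "r = 0")
    case True
    show ?thesis unfolding True
      by (rule curve_closedD[OF closed J curve curve, where f1 = "\<lambda>t. t" and g1 = "\<lambda>_. s"])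
        (auto intro: nz)
  qed (rule nz)
qed

lemma one_zero_block:
  assumes N: "(J, B, C) \<in> N3 n" and n: "n = Suc k"
    and corner: "B $$ (k, k) = 0" "C $$ (k, k) = 0"
  shows "(J, B, C) \<in> S"
proof -
  have B: "B \<in> carrier_mat n n" and C: "C \<in> carrier_mat n n"
    and nilB: "nilpotent_mat B" and nilC: "nilpotent_mat C"
    and JB: "J * B = B * J" and JC: "J * C = C * J" and BC: "B * C = C * B"
    using N by (auto simp: N3_def carrier_mat3_def)
  have kn: "k \<le> n" using n by simp
  \<comment> \<open>Row 0 determines the Toeplitz block. Its entry at column 0 is zero by
    nilpotency, so the list starts at column 1 and has length \<open>k - 1\<close>.\<close>
  define row where "row W = map (\<lambda>i. W $$ (0, Suc i)) [0..<k - 1]" for W :: "'a mat"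
  have decomp: "W = nil_poly (row W) J + cross k (W $$ (0, k)) (W $$ (k, k - 1))"
    if W: "W \<in> carrier_mat n n" "J * W = W * J" "nilpotent_mat W" "W $$ (k, k) = 0" for W
  proof (rule eq_matI)
    note facts = commutant_upper_right[OF W(1) k(1) kn W(2)] commutant_lower_left[OF W(1) k(1) kn W(2)]
      commutant_block[OF W(1) k(1) kn W(2)]
    have W00: "W $$ (0, 0) = 0"
      using nilpotent_mat_entry_00[OF W(1) _ W(3)] commutant_col_0[OF W(1) k(1) kn W(2)] k by simp
    fix i j assume "i < dim_row (nil_poly (row W) J + cross k (W $$ (0, k)) (W $$ (k, k - 1)))"
      "j < dim_col (nil_poly (row W) J + cross k (W $$ (0, k)) (W $$ (k, k - 1)))"
    then have ij: "i < n" "j < n" by (auto simp: n cross_def)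
    have "nil_poly (row W) J $$ (i, j) = (if i < j \<and> j < k then W $$ (0, j - i) else 0)"
      using nil_poly_jordan_part_index[OF ij kn, of "row W"] by (auto simp: row_def Suc_diff_Suc)
    then have "(nil_poly (row W) J + cross k (W $$ (0, k)) (W $$ (k, k - 1))) $$ (i, j) =
      (if i < j \<and> j < k then W $$ (0, j - i) else 0) +
      (if i = 0 \<and> j = k then W $$ (0, k) else if i = k \<and> j = k - 1 then W $$ (k, k - 1) else 0)"
      using ij by (simp add: cross_def n)
    also have "\<dots> = W $$ (i, j)"
    proof -
      consider "i < k" "j < k" | "i < k" "j = k" | "i = k" "j < k" | "i = k" "j = k"
        using ij n by linarith
      then show ?thesis
      proof cases
        case 1
        then show ?thesis using facts(3)[of i j] W00 by auto
      next
        case 2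
        then show ?thesis using facts(1)[of i j] n by auto
      next
        case 3
        then show ?thesis using facts(2)[of i j] n k by (cases "j = k - 1") auto
      next
        case 4
        then show ?thesis using W(4) k by auto
      qed
    qed
    finally show "W $$ (i, j) = (nil_poly (row W) J + cross k (W $$ (0, k)) (W $$ (k, k - 1))) $$ (i, j)" ..
  qed (use W in \<open>auto simp: cross_def n\<close>)
  let ?u = "B $$ (0, k)" and ?w = "B $$ (k, k - 1)" and ?z = "C $$ (0, k)" and ?y = "C $$ (k, k - 1)"
  \<comment> \<open>At this entry the two Toeplitz blocks contribute a convolution, symmetric in
    both factors; hence \<open>B * C = C * B\<close> leaves exactly
    \<open>u y = z w\<close>.\<close>
  have prod: "(V * W) $$ (0, k - 1) = (\<Sum>l = 0..<k. V $$ (0, l) * W $$ (0, k - 1 - l)) + V $$ (0, k) * W $$ (k, k - 1)"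
    if "V \<in> carrier_mat n n" "W \<in> carrier_mat n n" "J * W = W * J" for V W
  proof -
    have "(V * W) $$ (0, k - 1) = (\<Sum>l = 0..<k. V $$ (0, l) * W $$ (l, k - 1)) + V $$ (0, k) * W $$ (k, k - 1)"
      using mat_mult_index[OF that(1,2), of 0 "k - 1"] k n by simp
    also have "(\<Sum>l = 0..<k. V $$ (0, l) * W $$ (l, k - 1)) = (\<Sum>l = 0..<k. V $$ (0, l) * W $$ (0, k - 1 - l))"
    proof (rule sum.cong)
      fix l assume "l \<in> {0..<k}"
      then have "l < k" "l \<le> k - 1" by auto
      then show "V $$ (0, l) * W $$ (l, k - 1) = V $$ (0, l) * W $$ (0, k - 1 - l)"
        using commutant_block[OF that(2) k(1) kn that(3), of l "k - 1"] by auto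
    qed simp
    finally show ?thesis .
  qed
  have refl_sum: "(\<Sum>l = 0..<k. B $$ (0, l) * C $$ (0, k - 1 - l)) = (\<Sum>l = 0..<k. C $$ (0, l) * B $$ (0, k - 1 - l))"
    by (rule sum.reindex_bij_witness[of _ "\<lambda>l. k - 1 - l" "\<lambda>l. k - 1 - l"]) (auto simp: mult.commute)
  then have det: "?u * ?y = ?z * ?w"
  proof -
    have "(B * C) $$ (0, k - 1) = (C * B) $$ (0, k - 1)" by (simp only: BC)
    then show ?thesis unfolding prod[OF B C JC] prod[OF C B JB] refl_sum by (rule add_left_imp_eq)
  qed
  obtain \<alpha> \<beta> r s where ab: "?u = \<alpha> * r" "?w = \<alpha> * s" "?z = \<beta> * r" "?y = \<beta> * s"
    by (rule proportional_pairs[OF det])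
  have cross_smult: "cross k (c * r) (c * s) = c \<cdot>\<^sub>m cross k r s" for c
    by (rule eq_matI) (auto simp: cross_def)
  have "B = nil_poly (row B) J + \<alpha> \<cdot>\<^sub>m cross k r s"
    using decomp[OF B JB nilB corner(1)] unfolding ab cross_smult .
  moreover have "C = nil_poly (row C) J + \<beta> \<cdot>\<^sub>m cross k r s"
    using decomp[OF C JC nilC corner(2)] unfolding ab cross_smult .
  ultimately have "(J, B, C) = (J, nil_poly (row B) J + \<alpha> \<cdot>\<^sub>m cross k r s, nil_poly (row C) J + \<beta> \<cdot>\<^sub>m cross k r s)"
    by (intro arg_cong2[where f = Pair] refl)
  then show ?thesis by (rule ssubst) (rule cross_triple_in_S[OF n])
qed

lemma jordan_part_triple_in_S:
  assumes N: "(J, B, C) \<in> N3 n"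
  shows "(J, B, C) \<in> S"
proof (cases "\<exists>i j. k \<le> i \<and> i < n \<and> k \<le> j \<and> j < n \<and> (B $$ (i, j) \<noteq> 0 \<or> C $$ (i, j) \<noteq> 0)")
  case True
  have "B \<in> carrier_mat n n" "C \<in> carrier_mat n n" using N by (auto simp: N3_def carrier_mat3_def)
  then show ?thesis using True corner_nonzero_imp_has_minor[of B n C k] k has_minor_S[OF N]
    by (metis less_le_trans zero_less_numeral)
next
  case False
  then show ?thesis
    using two_zero_blocks[OF N] one_zero_block[OF N] k by (cases "n = Suc k") auto
qed

end

section \<open>The case of order one, where the first matrix is zero\<close>

lemma zero_triple_in_S:
  fixes S :: "'a :: alg_closed_field mat3 set"
  assumes closed: "curve_closed n S" and n: "1 < n"
    and has_minor_S: "\<And>X Y Z M. (X, Y, Z) \<in> N3 n \<Longrightarrow> M \<in> span3 X Y Z \<Longrightarrow> has_minor 1 n M \<Longrightarrow> (X, Y, Z) \<in> S"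
    and N: "(0\<^sub>m n n, B, C) \<in> N3 n"
  shows "(0\<^sub>m n n, B, C) \<in> S"
proof -
  have B: "B \<in> carrier_mat n n" and C: "C \<in> carrier_mat n n" using N by (auto simp: N3_def carrier_mat3_def)
  have Z: "0\<^sub>m n n \<in> carrier_mat n n" by simp
  have minor: "has_minor 1 n M" if "M \<in> carrier_mat n n" "i < n" "j < n" "M $$ (i, j) \<noteq> 0" for M :: "'a mat" and i j
    using that by (intro has_minorI[of _ n 1 "\<lambda>_. i" "\<lambda>_. j" "\<lambda>_. 1"]) (auto simp: det_single)
  have spanB: "B \<in> span3 (0\<^sub>m n n) B C"
  proof -
    have "B = 0 \<cdot>\<^sub>m 0\<^sub>m n n + 1 \<cdot>\<^sub>m B + 0 \<cdot>\<^sub>m C" using B C by (intro eq_matI) auto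
    then show ?thesis unfolding span3_def by blast
  qed
  have spanC: "C \<in> span3 (0\<^sub>m n n) B C"
  proof -
    have "C = 0 \<cdot>\<^sub>m 0\<^sub>m n n + 0 \<cdot>\<^sub>m B + 1 \<cdot>\<^sub>m C" using B C by (intro eq_matI) auto
    then show ?thesis unfolding span3_def by blast
  qed
  show ?thesis
  proof (cases "B = 0\<^sub>m n n \<and> C = 0\<^sub>m n n")
    case True
    \<comment> \<open>A nonzero entry is already a minor of order 1, so only the zero triple needs a
      curve; this one is nonzero for \<open>t \<noteq> 0\<close> because
      \<open>n > 1\<close>.\<close>
    let ?A = "\<lambda>t :: 'a. t \<cdot>\<^sub>m jordan_part n n"
    have z: "0\<^sub>m n n * W = (0\<^sub>m n n :: 'a mat)" "W * 0\<^sub>m n n = (0\<^sub>m n n :: 'a mat)" if "W \<in> carrier_mat n n" for W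
      using that by auto
    have nilZ: "nilpotent_mat (0\<^sub>m n n :: 'a mat)" by (rule nilpotent_mat_strict_upper[of _ n]) auto
    have "(?A 0, 0\<^sub>m n n, 0\<^sub>m n n) \<in> S"
    proof (rule curve_closedD[OF closed, where A = ?A and B = "\<lambda>_. 0\<^sub>m n n" and C = "\<lambda>_. 0\<^sub>m n n"])
      fix t :: 'a assume t: "t \<noteq> 0"
      have A: "?A t \<in> carrier_mat n n" by simp
      have "nilpotent_mat (?A t)"
        by (rule nilpotent_mat_strict_upper[of _ n]) (auto simp: jordan_part_def)
      then have "(?A t, 0\<^sub>m n n, 0\<^sub>m n n) \<in> N3 n"
        by (intro N3_I) (use nilZ z[OF A] in auto)
      moreover have "has_minor 1 n (?A t)"
        by (rule minor[OF A, of 0 1]) (use n t in \<open>auto simp: jordan_part_def\<close>)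
      ultimately show "(?A t, 0\<^sub>m n n, 0\<^sub>m n n) \<in> S"
        using has_minor_S[OF _ span3_first[OF A Z Z]] by blast
    qed (intro mat_curve_smult mat_curve_const poly_fun_id; simp)+
    moreover have "?A 0 = 0\<^sub>m n n" by (rule eq_matI) (auto simp: jordan_part_def)
    ultimately show ?thesis using True by simp
  next
    case False
    then obtain i j where "i < n" "j < n" "B $$ (i, j) \<noteq> 0 \<or> C $$ (i, j) \<noteq> 0"
      using B C by (metis eq_matI carrier_matD index_zero_mat)
    then show ?thesis using minor[OF B] minor[OF C] has_minor_S[OF N spanB] has_minor_S[OF N spanC] by blast
  qed
qed

section \<open>Reduction to Jordan form and conclusion\<close>

theorem proposition20:
  fixes A B C :: "'a :: alg_closed_field mat" and k n :: nat
  assumes "0 < k" and "k < n"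
    and "\<And>X Y Z :: 'a mat. (X, Y, Z) \<in> N3 n \<Longrightarrow>
           (\<exists>M \<in> span3 X Y Z. k \<le> vec_space.rank n M) \<Longrightarrow>
           (X, Y, Z) \<in> zariski n closure_of R3 n"
    and "(A, B, C) \<in> N3 n"
    and "jordan_nf A ((k, 0) # replicate (n - k) (1, 0))"
  shows "(A, B, C) \<in> zariski n closure_of R3 n"
proof -
  let ?J = "jordan_part n k :: 'a mat"
  let ?R = "zariski n closure_of R3 n :: 'a mat3 set"
  have car: "A \<in> carrier_mat n n" "B \<in> carrier_mat n n" "C \<in> carrier_mat n n"
    using assms(4) by (auto simp: N3_def carrier_mat3_def)
  have "similar_mat A ?J"
    using assms(5) jordan_part_jordan_matrix[of k n, where ?'a = 'a] assms(2) unfolding jordan_nf_def by simp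
  then obtain P Q where P: "P \<in> carrier_mat n n" and Q: "Q \<in> carrier_mat n n"
    and PQ: "P * Q = 1\<^sub>m n" and QP: "Q * P = 1\<^sub>m n" and A: "A = P * ?J * Q"
    using car(1) unfolding similar_mat_def similar_mat_wit_def Let_def by auto
  define S where "S = {(X, Y, Z). (P * X * Q, P * Y * Q, P * Z * Q) \<in> ?R}"
  have closed: "curve_closed n S"
    unfolding S_def by (rule curve_closed_conj[OF closedin_zariski_curve_closed P Q]) simp
  \<comment> \<open>Conjugation preserves \<open>N3 n\<close>, the span relation and the minor; only
    afterwards is the minor turned into the rank bound of the assumption.\<close>
  have S: "(X, Y, Z) \<in> S" if N: "(X, Y, Z) \<in> N3 n" and M: "M \<in> span3 X Y Z" "has_minor k n M" for X Y Z M
  proof -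
    have X: "X \<in> carrier_mat n n" and Y: "Y \<in> carrier_mat n n" and Z: "Z \<in> carrier_mat n n"
      using N by (auto simp: N3_def carrier_mat3_def)
    obtain a b c where M_eq: "M = a \<cdot>\<^sub>m X + b \<cdot>\<^sub>m Y + c \<cdot>\<^sub>m Z" using M(1) unfolding span3_def by blast
    have Mc: "M \<in> carrier_mat n n" using X Y Z by (simp add: M_eq)
    have sm: "P * (a \<cdot>\<^sub>m W) * Q = a \<cdot>\<^sub>m (P * W * Q)" if "W \<in> carrier_mat n n" for a W
      using mult_smult_distrib[OF P that] mult_smult_assoc_mat[OF mult_carrier_mat[OF P that] Q] by simp
    have ad: "P * (V + W) * Q = P * V * Q + P * W * Q" if "V \<in> carrier_mat n n" "W \<in> carrier_mat n n" for V W
      using mult_add_distrib_mat[OF P that]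
        add_mult_distrib_mat[OF mult_carrier_mat[OF P that(1)] mult_carrier_mat[OF P that(2)] Q] by simp
    have "P * M * Q = a \<cdot>\<^sub>m (P * X * Q) + b \<cdot>\<^sub>m (P * Y * Q) + c \<cdot>\<^sub>m (P * Z * Q)"
      unfolding M_eq using X Y Z by (simp add: ad sm)
    then have "P * M * Q \<in> span3 (P * X * Q) (P * Y * Q) (P * Z * Q)" unfolding span3_def by blast
    moreover have "k \<le> vec_space.rank n (P * M * Q)"
      using has_minor_rank[OF _ has_minor_conj[OF M(2) Mc P Q QP]] P Q Mc by simp
    ultimately show ?thesis
      unfolding S_def using assms(3)[OF N3_conj[OF N P Q PQ QP]] by blast
  qed
  have conj_back: "P * (Q * W * P) * Q = W" if W: "W \<in> carrier_mat n n" for W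
  proof -
    have "P * (Q * W * P) * Q = P * (Q * W) * P * Q"
      using assoc_mult_mat[OF P mult_carrier_mat[OF Q W] P] by simp
    also have "\<dots> = P * (Q * W)"
      using assoc_mult_mat[OF mult_carrier_mat[OF P mult_carrier_mat[OF Q W]] P Q] PQ
        right_mult_one_mat[OF mult_carrier_mat[OF P mult_carrier_mat[OF Q W]]] by simp
    also have "\<dots> = W" using assoc_mult_mat[OF P Q W] PQ W by simp
    finally show ?thesis .
  qed
  have J_eq: "Q * A * P = ?J"
  proof -
    have JQ: "?J * Q \<in> carrier_mat n n" by (rule mult_carrier_mat[OF jordan_part_carrier Q])
    have "Q * A * P = Q * (P * (?J * Q)) * P" unfolding A using assoc_mult_mat[OF P jordan_part_carrier Q] by simp
    also have "Q * (P * (?J * Q)) = ?J * Q"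
      using assoc_mult_mat[OF Q P JQ] left_mult_one_mat[OF JQ] unfolding QP by simp
    also have "?J * Q * P = ?J"
      using assoc_mult_mat[OF jordan_part_carrier[of n k] Q P] right_mult_one_mat[OF jordan_part_carrier[of n k]]
      unfolding QP by simp
    finally show ?thesis .
  qed
  have N: "(?J, Q * B * P, Q * C * P) \<in> N3 n"
    using N3_conj[OF assms(4) Q P QP PQ] unfolding J_eq .
  have "(?J, Q * B * P, Q * C * P) \<in> S"
  \<comment> \<open>The description of the commutant requires \<open>k \<ge> 2\<close>; for
    \<open>k = 1\<close> the Jordan part is the zero matrix.\<close>
  proof (cases "k = 1")
    case True
    have "?J = 0\<^sub>m n n" by (rule eq_matI) (auto simp: jordan_part_def True)
    then show ?thesis
      using zero_triple_in_S[OF closed _ _, of "Q * B * P" "Q * C * P"] S N assms(2) True by metis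
  next
    case False
    interpret perturbation n k S
      by unfold_locales (use closed S False assms(1,2) in auto)
    show ?thesis by (rule jordan_part_triple_in_S[OF N])
  qed
  then show ?thesis unfolding S_def using conj_back car A by simp
qed

end
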